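(* Let $B$ be a unital Banach algebra over $\mathbb{C}$ and let $\theta\in B^d$ with $\theta(1)=1$. For any $p\in\mathcal{Z}(B^d)$ the following conditions are equivalent: (1) there exists $q\in\mathcal{Z}(B^d)$ such that $D[q]=p$; (2) $\partial[p]=(\sigma\circ\partial)[p]$; (3) $(D\circ D_\theta^* )[p]=L_\theta[p]$.
   Context: $B^d$ is the topological dual of $B$; $M_n(B)=M_n(\mathbb{C})\otimes B$ with its natural (entrywise) topology; $M(B)=(M_n(B))_{n\ge1}$. $A(M(B))$ is the unital algebra (levelwise operations) of families $f=(f_n)_{n\ge1}$ of analytic maps $f_n:M_n(B)\to M_n(\mathbb{C})$ with $f_{m+n}(\beta\oplus\beta')=f_m(\beta)\oplus f_n(\beta')$ and $f_n((s\otimes1)\beta(s\otimes1)^{-1})=sf_n(\beta)s^{-1}$ for $s\in GL_n(\mathbb{C})$. $A(M(B);M(B))$ is the space of families of analytic maps $f_{m;n}:M_m(B)\times M_n(B)\to M_m(\mathbb{C})\otimes M_n(\mathbb{C})$ having these properties in each variable separately (acting on the corresponding tensor leg). For $\varphi\in B^d$, $z(\varphi)\in A(M(B))$ is $z(\varphi)_n=\mathrm{id}_{M_n(\mathbb{C})}\otimes\varphi$ (apply $\varphi$ entrywise). $\mathcal{Z}(B^d)$ is the unital subalgebra of $A(M(B))$ generated by $\{z(\varphi):\varphi\in B^d\}$. The algebraic tensor product $\mathcal{Z}(B^d)^{\otimes2}$ is viewed inside $A(M(B);M(B))$ via $(f\otimes g)_{m;n}(\beta;\beta')=f_m(\beta)\otimes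 g_n(\beta')$. $\partial:A(M(B))\to A(M(B);M(B))$ is $$(\partial f)_{m;n}(\beta;\beta')=\sum_{1\le a,b\le m,\,1\le c,d\le n}\Big(\tfrac{d}{d\epsilon}f_{m+n}\big(\left[\begin{smallmatrix}\beta&\epsilon e^{(m,n)}_{b,c}\otimes1\\0&\beta'\end{smallmatrix}\right]\big)\big|_{\epsilon=0}\Big)_{(a,m+d)}e^{(m)}_{a,b}\otimes e^{(n)}_{c,d}$$ ($e$'s are matrix units). It is a derivation, $\partial[z(\varphi)]=\varphi(1)\,1\otimes1$, and it maps $\mathcal{Z}(B^d)$ into $\mathcal{Z}(B^d)^{\otimes2}$. $\sigma$ is the flip $\sigma(f\otimes g)=g\otimes f$ on $\mathcal{Z}(B^d)^{\otimes2}$. The cyclic derivative is $(Df)_n(\beta)=\mathrm{mult}(\sigma((\partial f)_{n;n}(\beta;\beta)))$ with $\mathrm{mult}(a\otimes b)=ab$ and $\sigma(a\otimes b)=b\otimes a$ on $M_n(\mathbb{C})\otimes M_n(\mathbb{C})$. With $(a\otimes c)\#b=abc$, put $(\partial_\theta^*f)_n(\beta)=f_{n;n}(\beta;\beta)\#z(\theta)_n(\beta)$ for $f\in A(M(B);M(B))$; $D_\theta^*[f]=f\,z(\theta)$, $N_\theta=\partial_\theta^*\circ\partial$ and $L_\theta=N_\theta+\mathrm{id}$ on $A(M(B))$. *)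

theory Defs
  imports
    "HOL-Analysis.Derivative"
    "Jordan_Normal_Form.Matrix"
begin

section \<open>Unital complex Banach algebras and their dual\<close>

text \<open>
  The library's Banach algebras are real, so the complex scalar multiplication is added here.
  The normalisation \<open>norm 1 = 1\<close> is not imposed.
\<close>

class complex_banach_algebra_1 = real_normed_algebra + ring_1 + banach +
  fixes scaleC :: "complex \<Rightarrow> 'a \<Rightarrow> 'a"  (infixr \<open>*\<^sub>C\<close> 75)
  assumes scaleC_add_right: "a *\<^sub>C (x + y) = a *\<^sub>C x + a *\<^sub>C y"
    and scaleC_add_left: "(a + b) *\<^sub>C x = a *\<^sub>C x + b *\<^sub>C x"
    and scaleC_scaleC: "a *\<^sub>C b *\<^sub>C x = (a * b) *\<^sub>C x"
    and scaleC_one: "1 *\<^sub>C x = x"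
    and scaleR_eq_scaleC: "r *\<^sub>R x = complex_of_real r *\<^sub>C x"
    and norm_scaleC: "norm (a *\<^sub>C x) = cmod a * norm x"
    and mult_scaleC_left: "(a *\<^sub>C x) * y = a *\<^sub>C (x * y)"
    and mult_scaleC_right: "x * (a *\<^sub>C y) = a *\<^sub>C (x * y)"

definition topological_dual :: "('b::complex_banach_algebra_1 \<Rightarrow> complex) set" where
  "topological_dual = {\<phi>. bounded_linear \<phi> \<and> (\<forall>c x. \<phi> (c *\<^sub>C x) = c * \<phi> x)}"


section \<open>Families of maps on the levels of \<open>M(B)\<close>\<close>

text \<open>
  \<open>M\<^sub>n(B)\<close> is \<^term>\<open>carrier_mat n n\<close>. A family \<open>(f\<^sub>n)\<close>, \<open>n \<ge> 1\<close>, is stored as a function of \<open>n\<close>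
  and of a matrix that is \<^const>\<open>undefined\<close> outside the domain (\<open>n \<ge> 1\<close> and \<open>\<beta> \<in> M\<^sub>n(B)\<close>), so that
  equality of such functions is equality of families.
\<close>

type_synonym 'b family = "nat \<Rightarrow> 'b mat \<Rightarrow> complex mat"

definition restrict_family :: "'b family \<Rightarrow> 'b family" where
  "restrict_family F =
     (\<lambda>n \<beta>. if 1 \<le> n \<and> \<beta> \<in> carrier_mat n n then F n \<beta> else undefined)"

definition fam_one :: "'b family" where
  "fam_one = restrict_family (\<lambda>n \<beta>. 1\<^sub>m n)"

definition fam_add :: "'b family \<Rightarrow> 'b family \<Rightarrow> 'b family" where
  "fam_add f g = restrict_family (\<lambda>n \<beta>. f n \<beta> + g n \<beta>)"

definition fam_scale :: "complex \<Rightarrow> 'b family \<Rightarrow> 'b family" where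
  "fam_scale c f = restrict_family (\<lambda>n \<beta>. c \<cdot>\<^sub>m f n \<beta>)"

definition fam_mult :: "'b family \<Rightarrow> 'b family \<Rightarrow> 'b family" where
  "fam_mult f g = restrict_family (\<lambda>n \<beta>. f n \<beta> * g n \<beta>)"

text \<open>
  The sum of the norms of the entries induces the entrywise topology of \<open>M\<^sub>n(B)\<close>. Analyticity of a
  map between complex Banach spaces is complex Frechet differentiability at every point; since
  \<open>M\<^sub>n(\<complex>)\<close> is finite-dimensional, it is required of every matrix entry.
\<close>

definition entry_norm :: "nat \<Rightarrow> 'b::real_normed_vector mat \<Rightarrow> real" where
  "entry_norm n \<beta> = (\<Sum>i<n. \<Sum>j<n. norm (\<beta> $$ (i, j)))"

definition complex_frechet_at ::
  "nat \<Rightarrow> ('b::complex_banach_algebra_1 mat \<Rightarrow> complex) \<Rightarrow> ('b mat \<Rightarrow> complex) \<Rightarrow> 'b mat \<Rightarrow> bool"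
where
  "complex_frechet_at n g L \<beta> \<longleftrightarrow>
     (\<forall>h\<in>carrier_mat n n. \<forall>k\<in>carrier_mat n n. L (h + k) = L h + L k) \<and>
     (\<forall>c. \<forall>h\<in>carrier_mat n n. L (map_mat ((*\<^sub>C) c) h) = c * L h) \<and>
     (\<exists>K. \<forall>h\<in>carrier_mat n n. cmod (L h) \<le> K * entry_norm n h) \<and>
     (\<forall>e>0. \<exists>d>0. \<forall>h\<in>carrier_mat n n.
        entry_norm n h < d \<longrightarrow> cmod (g (\<beta> + h) - g \<beta> - L h) \<le> e * entry_norm n h)"

definition analytic_level ::
  "nat \<Rightarrow> ('b::complex_banach_algebra_1 mat \<Rightarrow> complex mat) \<Rightarrow> bool"
where
  "analytic_level n F \<longleftrightarrow>
     (\<forall>i<n. \<forall>j<n. \<forall>\<beta>\<in>carrier_mat n n. \<exists>L. complex_frechet_at n (\<lambda>\<gamma>. F \<gamma> $$ (i, j)) L \<beta>)"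

definition mat_dsum :: "'a::zero mat \<Rightarrow> 'a mat \<Rightarrow> 'a mat" where
  "mat_dsum \<beta> \<beta>' = four_block_mat \<beta> (0\<^sub>m (dim_row \<beta>) (dim_col \<beta>'))
                               (0\<^sub>m (dim_row \<beta>') (dim_col \<beta>)) \<beta>'"

text \<open>\<^term>\<open>amplify s\<close> is \<open>s \<otimes> 1\<close>.\<close>

definition amplify :: "complex mat \<Rightarrow> 'b::complex_banach_algebra_1 mat" where
  "amplify s = map_mat (\<lambda>c. c *\<^sub>C 1) s"

definition A_MB :: "'b::complex_banach_algebra_1 family set" where
  "A_MB = {f. restrict_family f = f \<and>
     (\<forall>n\<ge>1. \<forall>\<beta>\<in>carrier_mat n n. f n \<beta> \<in> carrier_mat n n) \<and>
     (\<forall>n\<ge>1. analytic_level n (f n)) \<and>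
     (\<forall>m\<ge>1. \<forall>n\<ge>1. \<forall>\<beta>\<in>carrier_mat m m. \<forall>\<beta>'\<in>carrier_mat n n.
        f (m + n) (mat_dsum \<beta> \<beta>') = mat_dsum (f m \<beta>) (f n \<beta>')) \<and>
     (\<forall>n\<ge>1. \<forall>\<beta>\<in>carrier_mat n n. \<forall>s\<in>carrier_mat n n. \<forall>t\<in>carrier_mat n n.
        s * t = 1\<^sub>m n \<and> t * s = 1\<^sub>m n \<longrightarrow>
        f n (amplify s * \<beta> * amplify t) = s * f n \<beta> * t)}"

definition zfun :: "('b \<Rightarrow> complex) \<Rightarrow> 'b family" where
  "zfun \<phi> = restrict_family (\<lambda>n \<beta>. map_mat \<phi> \<beta>)"

text \<open>The unital subalgebra generated by the \<^term>\<open>zfun \<phi>\<close>; see \<open>Z_Bd_subset_A_MB\<close> below.\<close>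

inductive_set Z_Bd :: "'b::complex_banach_algebra_1 family set" where
  zfun: "\<phi> \<in> topological_dual \<Longrightarrow> zfun \<phi> \<in> Z_Bd"
| one: "fam_one \<in> Z_Bd"
| add: "f \<in> Z_Bd \<Longrightarrow> g \<in> Z_Bd \<Longrightarrow> fam_add f g \<in> Z_Bd"
| scale: "f \<in> Z_Bd \<Longrightarrow> fam_scale c f \<in> Z_Bd"
| mult: "f \<in> Z_Bd \<Longrightarrow> g \<in> Z_Bd \<Longrightarrow> fam_mult f g \<in> Z_Bd"


section \<open>Two-variable families\<close>

text \<open>
  An element of \<open>M\<^sub>m(\<complex>) \<otimes> M\<^sub>n(\<complex>)\<close> is given by its coordinates: \<open>T a b c d\<close> is the coefficient of
  \<open>e\<^sub>a\<^sub>b \<otimes> e\<^sub>c\<^sub>d\<close> for \<open>a, b < m\<close> and \<open>c, d < n\<close> (indices start at 0), and 0 for other indices.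
\<close>

type_synonym mat_tensor = "nat \<Rightarrow> nat \<Rightarrow> nat \<Rightarrow> nat \<Rightarrow> complex"

definition tensor_of :: "nat \<Rightarrow> nat \<Rightarrow> mat_tensor \<Rightarrow> mat_tensor" where
  "tensor_of m n T = (\<lambda>a b c d. if a < m \<and> b < m \<and> c < n \<and> d < n then T a b c d else 0)"

definition pure_tensor :: "nat \<Rightarrow> nat \<Rightarrow> complex mat \<Rightarrow> complex mat \<Rightarrow> mat_tensor" where
  "pure_tensor m n X Y = tensor_of m n (\<lambda>a b c d. X $$ (a, b) * Y $$ (c, d))"

definition tensor_flip :: "mat_tensor \<Rightarrow> mat_tensor" where
  "tensor_flip T = (\<lambda>a b c d. T c d a b)"

text \<open>On \<open>M\<^sub>n(\<complex>) \<otimes> M\<^sub>n(\<complex>)\<close>: \<open>X \<otimes> Y \<mapsto> X Y\<close>, and \<open>(X \<otimes> Y) # W = X W Y\<close>.\<close>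

definition tensor_mult :: "nat \<Rightarrow> mat_tensor \<Rightarrow> complex mat" where
  "tensor_mult n T = Matrix.mat n n (\<lambda>(a, d). \<Sum>b<n. T a b b d)"

definition tensor_hash :: "nat \<Rightarrow> mat_tensor \<Rightarrow> complex mat \<Rightarrow> complex mat" where
  "tensor_hash n T W = Matrix.mat n n (\<lambda>(a, d). \<Sum>b<n. \<Sum>c<n. T a b c d * W $$ (b, c))"

type_synonym 'b bifamily = "nat \<Rightarrow> nat \<Rightarrow> 'b mat \<Rightarrow> 'b mat \<Rightarrow> mat_tensor"

definition restrict_bifamily :: "'b bifamily \<Rightarrow> 'b bifamily" where
  "restrict_bifamily G =
     (\<lambda>m n \<beta> \<beta>'. if 1 \<le> m \<and> 1 \<le> n \<and> \<beta> \<in> carrier_mat m m \<and> \<beta>' \<in> carrier_mat n n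
                 then G m n \<beta> \<beta>' else undefined)"

definition fam_tensor :: "'b family \<Rightarrow> 'b family \<Rightarrow> 'b bifamily" where
  "fam_tensor f g = restrict_bifamily (\<lambda>m n \<beta> \<beta>'. pure_tensor m n (f m \<beta>) (g n \<beta>'))"

definition bifam_add :: "'b bifamily \<Rightarrow> 'b bifamily \<Rightarrow> 'b bifamily" where
  "bifam_add F G =
     restrict_bifamily (\<lambda>m n \<beta> \<beta>' a b c d. F m n \<beta> \<beta>' a b c d + G m n \<beta> \<beta>' a b c d)"

definition bifam_scale :: "complex \<Rightarrow> 'b bifamily \<Rightarrow> 'b bifamily" where
  "bifam_scale r F = restrict_bifamily (\<lambda>m n \<beta> \<beta>' a b c d. r * F m n \<beta> \<beta>' a b c d)"

text \<open>
  The flip of the algebraic tensor square, written on the level of functions. It is the linear map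
  with \<open>f \<otimes> g \<mapsto> g \<otimes> f\<close> (\<open>flip_fam_tensor\<close>, \<open>flip_bifam_add\<close>, \<open>flip_bifam_scale\<close> below):
  besides the tensor legs, the two matrix arguments are exchanged.
\<close>

definition bifam_flip :: "'b bifamily \<Rightarrow> 'b bifamily" where
  "bifam_flip G = restrict_bifamily (\<lambda>m n \<beta> \<beta>'. tensor_flip (G n m \<beta>' \<beta>))"


section \<open>The derivations and the operators\<close>

text \<open>The \<open>m \<times> n\<close> matrix \<open>\<epsilon> e\<^sub>b\<^sub>c \<otimes> 1\<close> over \<open>B\<close>.\<close>

definition scaled_unit ::
  "nat \<Rightarrow> nat \<Rightarrow> nat \<Rightarrow> nat \<Rightarrow> complex \<Rightarrow> 'b::complex_banach_algebra_1 mat"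
where
  "scaled_unit m n b c \<epsilon> = Matrix.mat m n (\<lambda>(i, j). if i = b \<and> j = c then \<epsilon> *\<^sub>C 1 else 0)"

definition free_diff :: "'b::complex_banach_algebra_1 family \<Rightarrow> 'b bifamily" where
  "free_diff f = restrict_bifamily (\<lambda>m n \<beta> \<beta>'. tensor_of m n (\<lambda>a b c d.
     deriv (\<lambda>\<epsilon>. f (m + n) (four_block_mat \<beta> (scaled_unit m n b c \<epsilon>) (0\<^sub>m n m) \<beta>') $$ (a, m + d)) 0))"

definition cyclic_deriv :: "'b::complex_banach_algebra_1 family \<Rightarrow> 'b family" where
  "cyclic_deriv f = restrict_family (\<lambda>n \<beta>. tensor_mult n (tensor_flip (free_diff f n n \<beta> \<beta>)))"

definition free_diff_star :: "('b \<Rightarrow> complex) \<Rightarrow> 'b bifamily \<Rightarrow> 'b family" where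
  "free_diff_star \<theta> G = restrict_family (\<lambda>n \<beta>. tensor_hash n (G n n \<beta> \<beta>) (zfun \<theta> n \<beta>))"

definition cyclic_deriv_star :: "('b \<Rightarrow> complex) \<Rightarrow> 'b family \<Rightarrow> 'b family" where
  "cyclic_deriv_star \<theta> f = fam_mult f (zfun \<theta>)"

definition number_op ::
  "('b::complex_banach_algebra_1 \<Rightarrow> complex) \<Rightarrow> 'b family \<Rightarrow> 'b family" where
  "number_op \<theta> f = free_diff_star \<theta> (free_diff f)"

definition L_op ::
  "('b::complex_banach_algebra_1 \<Rightarrow> complex) \<Rightarrow> 'b family \<Rightarrow> 'b family" where
  "L_op \<theta> f = fam_add (number_op \<theta> f) f"


section \<open>Consistency checks\<close>

lemma tensor_mult_pure:
  assumes "X \<in> carrier_mat n n" "Y \<in> carrier_mat n n"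
  shows "tensor_mult n (pure_tensor n n X Y) = X * Y"
  by (rule eq_matI)
    (use assms in \<open>auto simp: tensor_mult_def pure_tensor_def tensor_of_def scalar_prod_def
      atLeast0LessThan intro!: sum.cong\<close>)

lemma tensor_hash_pure:
  assumes "X \<in> carrier_mat n n" "Y \<in> carrier_mat n n" "W \<in> carrier_mat n n"
  shows "tensor_hash n (pure_tensor n n X Y) W = X * W * Y"
proof (rule eq_matI)
  fix a d assume "a < dim_row (X * W * Y)" "d < dim_col (X * W * Y)"
  hence ad: "a < n" "d < n" using assms by auto
  have "(\<Sum>b<n. \<Sum>c<n. X $$ (a, b) * Y $$ (c, d) * W $$ (b, c)) =
        (\<Sum>b<n. X $$ (a, b) * (\<Sum>c<n. W $$ (b, c) * Y $$ (c, d)))"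
    by (simp add: sum_distrib_left mult_ac)
  thus "tensor_hash n (pure_tensor n n X Y) W $$ (a, d) = (X * W * Y) $$ (a, d)"
    using assms ad by (simp add: tensor_hash_def pure_tensor_def tensor_of_def scalar_prod_def
      atLeast0LessThan)
qed (use assms in \<open>auto simp: tensor_hash_def\<close>)

lemma flip_fam_tensor: "bifam_flip (fam_tensor f g) = fam_tensor g f"
  by (auto simp: bifam_flip_def fam_tensor_def restrict_bifamily_def tensor_flip_def
      pure_tensor_def tensor_of_def fun_eq_iff)

lemma flip_bifam_add: "bifam_flip (bifam_add F G) = bifam_add (bifam_flip F) (bifam_flip G)"
  by (auto simp: bifam_flip_def bifam_add_def restrict_bifamily_def tensor_flip_def fun_eq_iff)

lemma flip_bifam_scale: "bifam_flip (bifam_scale r F) = bifam_scale r (bifam_flip F)"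
  by (auto simp: bifam_flip_def bifam_scale_def restrict_bifamily_def tensor_flip_def fun_eq_iff)

lemma dual_zero: "\<phi> \<in> topological_dual \<Longrightarrow> \<phi> 0 = 0"
  by (simp add: topological_dual_def linear_0 bounded_linear.linear)

lemma dual_add: "\<phi> \<in> topological_dual \<Longrightarrow> \<phi> (x + y) = \<phi> x + \<phi> y"
  by (simp add: topological_dual_def linear_add bounded_linear.linear)

lemma dual_sum: "\<phi> \<in> topological_dual \<Longrightarrow> \<phi> (\<Sum>i\<in>I. x i) = (\<Sum>i\<in>I. \<phi> (x i))"
  by (simp add: topological_dual_def linear_sum bounded_linear.linear)

lemma dual_scaleC: "\<phi> \<in> topological_dual \<Longrightarrow> \<phi> (c *\<^sub>C x) = c * \<phi> x"
  by (simp add: topological_dual_def)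

lemma free_diff_zfun:
  assumes "\<phi> \<in> topological_dual"
  shows "free_diff (zfun \<phi>) = bifam_scale (\<phi> 1) (fam_tensor fam_one fam_one)"
proof -
  have "deriv (\<lambda>\<epsilon>. zfun \<phi> (m + n)
      (four_block_mat \<beta> (scaled_unit m n b c \<epsilon>) (0\<^sub>m n m) \<beta>') $$ (a, m + d)) 0 =
      \<phi> 1 * (1\<^sub>m m $$ (a, b) * 1\<^sub>m n $$ (c, d))"
    if "1 \<le> m" "1 \<le> n" "\<beta> \<in> carrier_mat m m" "\<beta>' \<in> carrier_mat n n"
      "a < m" "b < m" "c < n" "d < n" for m n a b c d \<beta> \<beta>'
  proof -
    have "(\<lambda>\<epsilon>. zfun \<phi> (m + n)
      (four_block_mat \<beta> (scaled_unit m n b c \<epsilon>) (0\<^sub>m n m) \<beta>') $$ (a, m + d)) =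
      (\<lambda>\<epsilon>. if a = b \<and> c = d then \<epsilon> * \<phi> 1 else 0)"
      using that assms
      by (auto simp: zfun_def restrict_family_def scaled_unit_def fun_eq_iff dual_zero dual_scaleC)
    thus ?thesis using that
      by (auto intro!: DERIV_imp_deriv derivative_eq_intros)
  qed
  thus ?thesis
    by (auto simp: free_diff_def bifam_scale_def fam_tensor_def fam_one_def restrict_family_def
        restrict_bifamily_def pure_tensor_def tensor_of_def fun_eq_iff)
qed


lemma entry_norm_nonneg: "0 \<le> entry_norm n h"
  by (simp add: entry_norm_def sum_nonneg)

lemma norm_entry_le: "i < n \<Longrightarrow> j < n \<Longrightarrow> norm (h $$ (i, j)) \<le> entry_norm n h"
proof -
  assume ij: "i < n" "j < n"
  have "norm (h $$ (i, j)) \<le> (\<Sum>j<n. norm (h $$ (i, j)))"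
    by (rule member_le_sum) (use ij in auto)
  also have "\<dots> \<le> entry_norm n h" unfolding entry_norm_def
    by (rule member_le_sum[where f = "\<lambda>i. \<Sum>j<n. norm (h $$ (i, j))"])
      (use ij in \<open>auto intro: sum_nonneg\<close>)
  finally show ?thesis .
qed

lemma complex_frechetI:
  assumes "\<And>h k. h \<in> carrier_mat n n \<Longrightarrow> k \<in> carrier_mat n n \<Longrightarrow> L (h + k) = L h + L k"
    and "\<And>c h. h \<in> carrier_mat n n \<Longrightarrow> L (map_mat ((*\<^sub>C) c) h) = c * L h"
    and "\<exists>K. \<forall>h\<in>carrier_mat n n. cmod (L h) \<le> K * entry_norm n h"
    and "\<And>e. e > 0 \<Longrightarrow> \<exists>d>0. \<forall>h\<in>carrier_mat n n.
        entry_norm n h < d \<longrightarrow> cmod (g (\<beta> + h) - g \<beta> - L h) \<le> e * entry_norm n h"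
  shows "complex_frechet_at n g L \<beta>"
  using assms unfolding complex_frechet_at_def by blast

lemma complex_frechet_linear:
  assumes "complex_frechet_at n g L \<beta>"
  shows "h \<in> carrier_mat n n \<Longrightarrow> k \<in> carrier_mat n n \<Longrightarrow> L (h + k) = L h + L k"
    and "h \<in> carrier_mat n n \<Longrightarrow> L (map_mat ((*\<^sub>C) c) h) = c * L h"
  using assms unfolding complex_frechet_at_def by blast+

lemma complex_frechet_cong:
  assumes "complex_frechet_at n g L \<beta>" "\<beta> \<in> carrier_mat n n"
    and "\<And>\<gamma>. \<gamma> \<in> carrier_mat n n \<Longrightarrow> g' \<gamma> = g \<gamma>"
  shows "complex_frechet_at n g' L \<beta>"
proof -
  have "g' (\<beta> + h) = g (\<beta> + h)" if "h \<in> carrier_mat n n" for h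
    using assms that by simp
  thus ?thesis using assms unfolding complex_frechet_at_def by simp
qed

lemma complex_frechet_const: "complex_frechet_at n (\<lambda>_. c) (\<lambda>_. 0) \<beta>"
  unfolding complex_frechet_at_def
  by (auto intro!: exI[of _ 0] exI[of _ 1] simp: entry_norm_nonneg)

lemma complex_frechet_entry:
  assumes "\<phi> \<in> topological_dual" "i < n" "j < n" "\<beta> \<in> carrier_mat n n"
  shows "complex_frechet_at n (\<lambda>\<gamma>. \<phi> (\<gamma> $$ (i, j))) (\<lambda>h. \<phi> (h $$ (i, j))) \<beta>"
proof -
  have "bounded_linear \<phi>" using assms by (simp add: topological_dual_def)
  then obtain K where K: "0 < K" "\<And>x. norm (\<phi> x) \<le> norm x * K"
    using bounded_linear.pos_bounded by blast
  have "cmod (\<phi> (h $$ (i, j))) \<le> K * entry_norm n h" for h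
  proof -
    have "cmod (\<phi> (h $$ (i, j))) \<le> norm (h $$ (i, j)) * K" by (rule K(2))
    also have "\<dots> \<le> entry_norm n h * K"
      using K(1) by (intro mult_right_mono norm_entry_le assms) auto
    finally show ?thesis by (simp add: mult.commute)
  qed
  hence "\<exists>K. \<forall>h\<in>carrier_mat n n. cmod (\<phi> (h $$ (i, j))) \<le> K * entry_norm n h" by blast
  thus ?thesis using assms
    by (intro complex_frechetI)
      (auto simp: dual_add dual_scaleC entry_norm_nonneg intro!: exI[of _ 1])
qed

lemma complex_frechet_add:
  assumes f: "complex_frechet_at n f Lf \<beta>" and g: "complex_frechet_at n g Lg \<beta>"
  shows "complex_frechet_at n (\<lambda>\<gamma>. f \<gamma> + g \<gamma>) (\<lambda>h. Lf h + Lg h) \<beta>"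
proof -
  from f obtain Kf where Kf: "\<forall>h\<in>carrier_mat n n. cmod (Lf h) \<le> Kf * entry_norm n h"
    unfolding complex_frechet_at_def by blast
  from g obtain Kg where Kg: "\<forall>h\<in>carrier_mat n n. cmod (Lg h) \<le> Kg * entry_norm n h"
    unfolding complex_frechet_at_def by blast
  have K: "\<exists>K. \<forall>h\<in>carrier_mat n n. cmod (Lf h + Lg h) \<le> K * entry_norm n h"
  proof (intro exI ballI)
    fix h :: "'a mat" assume h: "h \<in> carrier_mat n n"
    show "cmod (Lf h + Lg h) \<le> (Kf + Kg) * entry_norm n h"
      using bspec[OF Kf h] bspec[OF Kg h] norm_triangle_ineq[of "Lf h" "Lg h"]
      by (simp add: distrib_right)
  qed
  have E: "\<exists>d>0. \<forall>h\<in>carrier_mat n n. entry_norm n h < d \<longrightarrow>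
      cmod (f (\<beta> + h) + g (\<beta> + h) - (f \<beta> + g \<beta>) - (Lf h + Lg h)) \<le> e * entry_norm n h"
    if "e > 0" for e
  proof -
    from that have e2: "e / 2 > 0" by simp
    from f e2 obtain d1 where d1: "d1 > 0" "\<forall>h\<in>carrier_mat n n. entry_norm n h < d1 \<longrightarrow>
        cmod (f (\<beta> + h) - f \<beta> - Lf h) \<le> e / 2 * entry_norm n h"
      unfolding complex_frechet_at_def by blast
    from g e2 obtain d2 where d2: "d2 > 0" "\<forall>h\<in>carrier_mat n n. entry_norm n h < d2 \<longrightarrow>
        cmod (g (\<beta> + h) - g \<beta> - Lg h) \<le> e / 2 * entry_norm n h"
      unfolding complex_frechet_at_def by blast
    show ?thesis
    proof (intro exI[of _ "min d1 d2"] conjI ballI impI)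
      fix h :: "'a mat" assume h: "h \<in> carrier_mat n n" "entry_norm n h < min d1 d2"
      have "cmod (f (\<beta> + h) + g (\<beta> + h) - (f \<beta> + g \<beta>) - (Lf h + Lg h)) =
            cmod ((f (\<beta> + h) - f \<beta> - Lf h) + (g (\<beta> + h) - g \<beta> - Lg h))"
        by (simp add: algebra_simps)
      also have "\<dots> \<le> cmod (f (\<beta> + h) - f \<beta> - Lf h) + cmod (g (\<beta> + h) - g \<beta> - Lg h)"
        by (rule norm_triangle_ineq)
      also have "\<dots> \<le> e / 2 * entry_norm n h + e / 2 * entry_norm n h"
        using d1(2) d2(2) h by (intro add_mono) auto
      finally show "cmod (f (\<beta> + h) + g (\<beta> + h) - (f \<beta> + g \<beta>) - (Lf h + Lg h))
          \<le> e * entry_norm n h" by simp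
    qed (use d1 d2 in auto)
  qed
  show ?thesis
  proof (rule complex_frechetI)
    fix h k :: "'a mat" and c
    assume h: "h \<in> carrier_mat n n"
    show "Lf (map_mat ((*\<^sub>C) c) h) + Lg (map_mat ((*\<^sub>C) c) h) = c * (Lf h + Lg h)"
      by (simp add: complex_frechet_linear(2)[OF f h] complex_frechet_linear(2)[OF g h] algebra_simps)
    assume k: "k \<in> carrier_mat n n"
    show "Lf (h + k) + Lg (h + k) = Lf h + Lg h + (Lf k + Lg k)"
      by (simp add: complex_frechet_linear(1)[OF f h k] complex_frechet_linear(1)[OF g h k])
  qed (use K E in auto)
qed

lemma complex_frechet_mult:
  assumes f: "complex_frechet_at n f Lf \<beta>" and g: "complex_frechet_at n g Lg \<beta>"
  shows "complex_frechet_at n (\<lambda>\<gamma>. f \<gamma> * g \<gamma>) (\<lambda>h. f \<beta> * Lg h + g \<beta> * Lf h) \<beta>"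
proof -
  from f obtain Kf0 where Kf0: "\<forall>h\<in>carrier_mat n n. cmod (Lf h) \<le> Kf0 * entry_norm n h"
    unfolding complex_frechet_at_def by blast
  define Kf where "Kf = max Kf0 0"
  have Kf: "cmod (Lf h) \<le> Kf * entry_norm n h" if "h \<in> carrier_mat n n" for h
    using bspec[OF Kf0 that] mult_right_mono[of Kf0 Kf "entry_norm n h"] entry_norm_nonneg[of n h]
    unfolding Kf_def by linarith
  have Kf_nn: "Kf \<ge> 0" unfolding Kf_def by simp
  from g obtain Kg0 where Kg0: "\<forall>h\<in>carrier_mat n n. cmod (Lg h) \<le> Kg0 * entry_norm n h"
    unfolding complex_frechet_at_def by blast
  define Kg where "Kg = max Kg0 0"
  have Kg: "cmod (Lg h) \<le> Kg * entry_norm n h" if "h \<in> carrier_mat n n" for h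
    using bspec[OF Kg0 that] mult_right_mono[of Kg0 Kg "entry_norm n h"] entry_norm_nonneg[of n h]
    unfolding Kg_def by linarith
  have Kg_nn: "Kg \<ge> 0" unfolding Kg_def by simp
  have K: "\<exists>K. \<forall>h\<in>carrier_mat n n. cmod (f \<beta> * Lg h + g \<beta> * Lf h) \<le> K * entry_norm n h"
  proof (intro exI ballI)
    fix h :: "'a mat" assume h: "h \<in> carrier_mat n n"
    have "cmod (f \<beta> * Lg h + g \<beta> * Lf h) \<le> cmod (f \<beta>) * cmod (Lg h) + cmod (g \<beta>) * cmod (Lf h)"
      by (metis norm_mult norm_triangle_ineq)
    also have "\<dots> \<le> cmod (f \<beta>) * (Kg * entry_norm n h) + cmod (g \<beta>) * (Kf * entry_norm n h)"
      by (intro add_mono mult_left_mono Kf Kg h) auto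
    finally show "cmod (f \<beta> * Lg h + g \<beta> * Lf h) \<le>
        (cmod (f \<beta>) * Kg + cmod (g \<beta>) * Kf) * entry_norm n h" by (simp add: algebra_simps)
  qed
  have E: "\<exists>d>0. \<forall>h\<in>carrier_mat n n. entry_norm n h < d \<longrightarrow>
      cmod (f (\<beta> + h) * g (\<beta> + h) - f \<beta> * g \<beta> - (f \<beta> * Lg h + g \<beta> * Lf h)) \<le> e * entry_norm n h"
    if e: "e > 0" for e
  proof -
    define M where "M = cmod (f \<beta>) + Kf + 1 + cmod (g \<beta>)"
    have M: "M > 0" unfolding M_def using Kf_nn by (simp add: add_nonneg_pos add_pos_nonneg)
    define e' where "e' = min 1 (e / (2 * M))"
    have e': "e' > 0" "e' \<le> 1" "e' * M \<le> e / 2"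
    proof -
      show "e' > 0" "e' \<le> 1" unfolding e'_def using e M by auto
      have "e' * M \<le> e / (2 * M) * M" unfolding e'_def using M by (intro mult_right_mono) auto
      thus "e' * M \<le> e / 2" using M by simp
    qed
    from f e'(1) obtain d1 where d1: "d1 > 0" "\<forall>h\<in>carrier_mat n n. entry_norm n h < d1 \<longrightarrow>
        cmod (f (\<beta> + h) - f \<beta> - Lf h) \<le> e' * entry_norm n h"
      unfolding complex_frechet_at_def by blast
    from g e'(1) obtain d2 where d2: "d2 > 0" "\<forall>h\<in>carrier_mat n n. entry_norm n h < d2 \<longrightarrow>
        cmod (g (\<beta> + h) - g \<beta> - Lg h) \<le> e' * entry_norm n h"
      unfolding complex_frechet_at_def by blast
    define d3 where "d3 = e / (2 * ((Kf + 1) * (Kg + 1)))"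
    have d3: "d3 > 0" unfolding d3_def using e Kf_nn Kg_nn by simp
    define d where "d = min (min d1 d2) (min 1 d3)"
    show ?thesis
    proof (intro exI[of _ d] conjI ballI impI)
      show "d > 0" unfolding d_def using d1 d2 d3 by simp
      fix h :: "'a mat" assume h: "h \<in> carrier_mat n n" "entry_norm n h < d"
      let ?t = "entry_norm n h"
      let ?rf = "f (\<beta> + h) - f \<beta> - Lf h" and ?rg = "g (\<beta> + h) - g \<beta> - Lg h"
      have t: "0 \<le> ?t" "?t < d1" "?t < d2" "?t \<le> 1" "?t \<le> d3"
        using h entry_norm_nonneg[of n h] unfolding d_def by auto
      have rf: "cmod ?rf \<le> e' * ?t" and rg: "cmod ?rg \<le> e' * ?t"
        using d1(2) d2(2) h t by auto
      have "cmod (f (\<beta> + h) - f \<beta>) = cmod (?rf + Lf h)" by simp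
      also have "\<dots> \<le> cmod ?rf + cmod (Lf h)" by (rule norm_triangle_ineq)
      also have "\<dots> \<le> e' * ?t + Kf * ?t" using rf Kf[OF h(1)] by linarith
      also have "\<dots> \<le> (Kf + 1) * ?t"
        using mult_right_mono[OF e'(2) t(1)] by (simp add: algebra_simps)
      finally have df: "cmod (f (\<beta> + h) - f \<beta>) \<le> (Kf + 1) * ?t" .
      have "cmod (f (\<beta> + h)) \<le> cmod (f \<beta>) + cmod (f (\<beta> + h) - f \<beta>)"
        by (metis add.commute diff_add_cancel norm_triangle_ineq)
      also have "\<dots> \<le> cmod (f \<beta>) + (Kf + 1)"
        using df mult_left_le[OF t(4), of "Kf + 1"] Kf_nn by linarith
      finally have fb: "cmod (f (\<beta> + h)) \<le> cmod (f \<beta>) + Kf + 1" by simp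
      have "f (\<beta> + h) * g (\<beta> + h) - f \<beta> * g \<beta> - (f \<beta> * Lg h + g \<beta> * Lf h) =
            f (\<beta> + h) * ?rg + g \<beta> * ?rf + (f (\<beta> + h) - f \<beta>) * Lg h"
        by (simp add: algebra_simps)
      also have "cmod \<dots> \<le> cmod (f (\<beta> + h)) * cmod ?rg + cmod (g \<beta>) * cmod ?rf +
            cmod (f (\<beta> + h) - f \<beta>) * cmod (Lg h)"
        unfolding norm_mult[symmetric] by (intro order_trans[OF norm_triangle_ineq] add_mono order_refl norm_triangle_ineq)
      also have "\<dots> \<le> (cmod (f \<beta>) + Kf + 1) * (e' * ?t) + cmod (g \<beta>) * (e' * ?t) +
            ((Kf + 1) * ?t) * (Kg * ?t)"
        using t Kf_nn Kg_nn by (intro add_mono mult_mono fb rg rf df Kg h) auto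
      also have "\<dots> = (e' * M) * ?t + ((Kf + 1) * Kg * ?t) * ?t"
        unfolding M_def by (simp add: algebra_simps)
      also have "\<dots> \<le> e / 2 * ?t + e / 2 * ?t"
      proof (intro add_mono mult_right_mono e'(3) t(1))
        have "(Kf + 1) * Kg * ?t \<le> (Kf + 1) * (Kg + 1) * d3"
          using t Kf_nn Kg_nn by (intro mult_mono) auto
        also have "\<dots> = e / 2" 
          unfolding d3_def using Kf_nn Kg_nn by (simp add: add_nonneg_eq_0_iff)
        finally show "(Kf + 1) * Kg * ?t \<le> e / 2" .
      qed
      finally show "cmod (f (\<beta> + h) * g (\<beta> + h) - f \<beta> * g \<beta> - (f \<beta> * Lg h + g \<beta> * Lf h))
          \<le> e * ?t" by simp
    qed
  qed
  show ?thesis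
  proof (rule complex_frechetI)
    fix h k :: "'a mat" and c
    assume h: "h \<in> carrier_mat n n"
    show "f \<beta> * Lg (map_mat ((*\<^sub>C) c) h) + g \<beta> * Lf (map_mat ((*\<^sub>C) c) h) =
        c * (f \<beta> * Lg h + g \<beta> * Lf h)"
      by (simp add: complex_frechet_linear(2)[OF f h] complex_frechet_linear(2)[OF g h] algebra_simps)
    assume k: "k \<in> carrier_mat n n"
    show "f \<beta> * Lg (h + k) + g \<beta> * Lf (h + k) =
        f \<beta> * Lg h + g \<beta> * Lf h + (f \<beta> * Lg k + g \<beta> * Lf k)"
      by (simp add: complex_frechet_linear(1)[OF f h k] complex_frechet_linear(1)[OF g h k] algebra_simps)
  qed (use K E in auto)
qed

lemma complex_frechet_sum:
  assumes "finite I" "\<And>i. i \<in> I \<Longrightarrow> \<exists>L. complex_frechet_at n (g i) L \<beta>"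
  shows "\<exists>L. complex_frechet_at n (\<lambda>\<gamma>. \<Sum>i\<in>I. g i \<gamma>) L \<beta>"
  using assms
proof (induction I rule: finite_induct)
  case empty
  show ?case using complex_frechet_const[of n 0 \<beta>] by auto
next
  case (insert i I)
  then obtain L1 L2 where "complex_frechet_at n (g i) L1 \<beta>"
    "complex_frechet_at n (\<lambda>\<gamma>. \<Sum>i\<in>I. g i \<gamma>) L2 \<beta>" by blast
  from complex_frechet_add[OF this] show ?case using insert by auto
qed

lemma analytic_levelI:
  assumes "\<And>i j \<beta>. i < n \<Longrightarrow> j < n \<Longrightarrow> \<beta> \<in> carrier_mat n n \<Longrightarrow> \<exists>L. complex_frechet_at n (g i j) L \<beta>"
    and "\<And>i j \<gamma>. i < n \<Longrightarrow> j < n \<Longrightarrow> \<gamma> \<in> carrier_mat n n \<Longrightarrow> F \<gamma> $$ (i, j) = g i j \<gamma>"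
  shows "analytic_level n F"
  unfolding analytic_level_def
proof (intro allI impI ballI)
  fix i j :: nat and \<beta> :: "'a mat" assume ij: "i < n" "j < n" and b: "\<beta> \<in> carrier_mat n n"
  obtain L where "complex_frechet_at n (g i j) L \<beta>" using assms(1)[OF ij b] by blast
  from complex_frechet_cong[OF this b, of "\<lambda>\<gamma>. F \<gamma> $$ (i, j)"] assms(2)[OF ij]
  show "\<exists>L. complex_frechet_at n (\<lambda>\<gamma>. F \<gamma> $$ (i, j)) L \<beta>" by blast
qed

lemma analytic_levelD:
  "analytic_level n F \<Longrightarrow> i < n \<Longrightarrow> j < n \<Longrightarrow> \<beta> \<in> carrier_mat n n \<Longrightarrow>
   \<exists>L. complex_frechet_at n (\<lambda>\<gamma>. F \<gamma> $$ (i, j)) L \<beta>"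
  unfolding analytic_level_def by blast

lemma mat_dsum_carrier:
  "\<beta> \<in> carrier_mat m m \<Longrightarrow> \<beta>' \<in> carrier_mat n n \<Longrightarrow> mat_dsum \<beta> \<beta>' \<in> carrier_mat (m + n) (m + n)"
  by (simp add: mat_dsum_def four_block_carrier_mat)

lemma amplify_carrier: "s \<in> carrier_mat n n \<Longrightarrow> amplify s \<in> carrier_mat n n"
  by (simp add: amplify_def)

lemma similarity_carrier:
  "s \<in> carrier_mat n n \<Longrightarrow> t \<in> carrier_mat n n \<Longrightarrow> \<beta> \<in> carrier_mat n n \<Longrightarrow>
   amplify s * \<beta> * amplify t \<in> carrier_mat n n"
  using amplify_carrier by (meson mult_carrier_mat)

lemma A_MB_D:
  assumes "f \<in> A_MB" "1 \<le> n"
  shows "\<beta> \<in> carrier_mat n n \<Longrightarrow> f n \<beta> \<in> carrier_mat n n"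
    and "analytic_level n (f n)"
    and "1 \<le> m \<Longrightarrow> \<beta> \<in> carrier_mat m m \<Longrightarrow> \<beta>' \<in> carrier_mat n n \<Longrightarrow>
           f (m + n) (mat_dsum \<beta> \<beta>') = mat_dsum (f m \<beta>) (f n \<beta>')"
    and "\<beta> \<in> carrier_mat n n \<Longrightarrow> s \<in> carrier_mat n n \<Longrightarrow> t \<in> carrier_mat n n \<Longrightarrow>
           s * t = 1\<^sub>m n \<Longrightarrow> t * s = 1\<^sub>m n \<Longrightarrow>
           f n (amplify s * \<beta> * amplify t) = s * f n \<beta> * t"
  using assms unfolding A_MB_def by blast+

lemma A_MB_I:
  assumes "\<And>n \<beta>. 1 \<le> n \<Longrightarrow> \<beta> \<in> carrier_mat n n \<Longrightarrow> F n \<beta> \<in> carrier_mat n n"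
    and "\<And>n. 1 \<le> n \<Longrightarrow> analytic_level n (F n)"
    and "\<And>m n \<beta> \<beta>'. 1 \<le> m \<Longrightarrow> 1 \<le> n \<Longrightarrow> \<beta> \<in> carrier_mat m m \<Longrightarrow> \<beta>' \<in> carrier_mat n n \<Longrightarrow>
           F (m + n) (mat_dsum \<beta> \<beta>') = mat_dsum (F m \<beta>) (F n \<beta>')"
    and "\<And>n \<beta> s t. 1 \<le> n \<Longrightarrow> \<beta> \<in> carrier_mat n n \<Longrightarrow> s \<in> carrier_mat n n \<Longrightarrow>
           t \<in> carrier_mat n n \<Longrightarrow> s * t = 1\<^sub>m n \<Longrightarrow> t * s = 1\<^sub>m n \<Longrightarrow>
           F n (amplify s * \<beta> * amplify t) = s * F n \<beta> * t"
  shows "restrict_family F \<in> A_MB"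
proof -
  have an: "analytic_level n (restrict_family F n)" if n: "1 \<le> n" for n
  proof (rule analytic_levelI[where g = "\<lambda>i j \<gamma>. F n \<gamma> $$ (i, j)"])
    show "\<exists>L. complex_frechet_at n (\<lambda>\<gamma>. F n \<gamma> $$ (i, j)) L \<beta>"
      if "i < n" "j < n" "\<beta> \<in> carrier_mat n n" for i j \<beta>
      using assms(2)[OF n] that unfolding analytic_level_def by blast
  qed (use n in \<open>simp add: restrict_family_def\<close>)
  have idem: "restrict_family (restrict_family F) = restrict_family F"
    by (auto simp: restrict_family_def fun_eq_iff)
  show ?thesis unfolding A_MB_def mem_Collect_eq
  proof (intro conjI idem allI ballI impI an)
    fix m n :: nat and \<beta> \<beta>' :: "'a mat"
    assume "1 \<le> m" "1 \<le> n" "\<beta> \<in> carrier_mat m m" "\<beta>' \<in> carrier_mat n n"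
    thus "restrict_family F (m + n) (mat_dsum \<beta> \<beta>') =
        mat_dsum (restrict_family F m \<beta>) (restrict_family F n \<beta>')"
      using mat_dsum_carrier[of \<beta> m \<beta>' n] assms(3) by (simp add: restrict_family_def)
  next
    fix n :: nat and \<beta> :: "'a mat" and s t :: "complex mat"
    assume "1 \<le> n" "\<beta> \<in> carrier_mat n n" "s \<in> carrier_mat n n" "t \<in> carrier_mat n n"
      "s * t = 1\<^sub>m n \<and> t * s = 1\<^sub>m n"
    thus "restrict_family F n (amplify s * \<beta> * amplify t) = s * restrict_family F n \<beta> * t"
      using similarity_carrier[of s n t \<beta>] assms(4) by (simp add: restrict_family_def)
  qed (use assms(1) in \<open>auto simp: restrict_family_def\<close>)
qed

lemma zfun_in_A_MB:
  assumes "\<phi> \<in> topological_dual"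
  shows "zfun \<phi> \<in> A_MB"
  unfolding zfun_def
proof (rule A_MB_I)
  fix n :: nat
  show "analytic_level n (map_mat \<phi>)"
    by (rule analytic_levelI[where g = "\<lambda>i j \<gamma>. \<phi> (\<gamma> $$ (i, j))"])
      (use complex_frechet_entry[OF assms] in \<open>auto, blast\<close>)
next
  fix m n :: nat and \<beta> \<beta>' :: "'a mat"
  assume "\<beta> \<in> carrier_mat m m" "\<beta>' \<in> carrier_mat n n"
  thus "map_mat \<phi> (mat_dsum \<beta> \<beta>') = mat_dsum (map_mat \<phi> \<beta>) (map_mat \<phi> \<beta>')"
    by (intro eq_matI) (auto simp: mat_dsum_def dual_zero[OF assms])
next
  fix n :: nat and \<beta> :: "'a mat" and s t :: "complex mat"
  assume c: "\<beta> \<in> carrier_mat n n" "s \<in> carrier_mat n n" "t \<in> carrier_mat n n"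
  show "map_mat \<phi> (amplify s * \<beta> * amplify t) = s * map_mat \<phi> \<beta> * t"
  proof (rule eq_matI)
    fix i j assume "i < dim_row (s * map_mat \<phi> \<beta> * t)" "j < dim_col (s * map_mat \<phi> \<beta> * t)"
    hence ij: "i < n" "j < n" using c by auto
    show "map_mat \<phi> (amplify s * \<beta> * amplify t) $$ (i, j) = (s * map_mat \<phi> \<beta> * t) $$ (i, j)"
      using c ij by (simp add: amplify_def scalar_prod_def dual_sum[OF assms]
        dual_scaleC[OF assms] mult_scaleC_left mult_scaleC_right mult.commute)
  qed (use c in \<open>auto simp: amplify_def\<close>)
qed simp

lemma fam_one_in_A_MB: "fam_one \<in> A_MB"
  unfolding fam_one_def
proof (rule A_MB_I)
  fix n :: nat
  show "analytic_level n (\<lambda>\<beta>::'a mat. 1\<^sub>m n)"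
    unfolding analytic_level_def using complex_frechet_const by blast
next
  fix n :: nat and s t :: "complex mat"
  assume "s \<in> carrier_mat n n" "t \<in> carrier_mat n n" "s * t = 1\<^sub>m n"
  thus "1\<^sub>m n = s * 1\<^sub>m n * t" by simp
qed (auto simp: mat_dsum_def)

lemma fam_add_in_A_MB:
  assumes f: "f \<in> A_MB" and g: "g \<in> A_MB"
  shows "fam_add f g \<in> A_MB"
  unfolding fam_add_def
proof (rule A_MB_I)
  fix n :: nat assume n: "1 \<le> n"
  show "analytic_level n (\<lambda>\<beta>. f n \<beta> + g n \<beta>)"
  proof (rule analytic_levelI[where g = "\<lambda>i j \<gamma>. f n \<gamma> $$ (i, j) + g n \<gamma> $$ (i, j)"])
    show "\<exists>L. complex_frechet_at n (\<lambda>\<gamma>. f n \<gamma> $$ (i, j) + g n \<gamma> $$ (i, j)) L \<beta>"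
      if ij: "i < n" "j < n" "\<beta> \<in> carrier_mat n n" for i j \<beta>
    proof -
      obtain L1 where 1: "complex_frechet_at n (\<lambda>\<gamma>. f n \<gamma> $$ (i, j)) L1 \<beta>"
        using analytic_levelD[OF A_MB_D(2)[OF f n] ij] by blast
      obtain L2 where 2: "complex_frechet_at n (\<lambda>\<gamma>. g n \<gamma> $$ (i, j)) L2 \<beta>"
        using analytic_levelD[OF A_MB_D(2)[OF g n] ij] by blast
      show ?thesis by (rule exI, rule complex_frechet_add[OF 1 2])
    qed
  next
    show "(f n \<gamma> + g n \<gamma>) $$ (i, j) = f n \<gamma> $$ (i, j) + g n \<gamma> $$ (i, j)"
      if "i < n" "j < n" "\<gamma> \<in> carrier_mat n n" for i j \<gamma>
      using A_MB_D(1)[OF f n that(3)] A_MB_D(1)[OF g n that(3)] that by simp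
  qed
next
  fix m n :: nat and \<beta> \<beta>' :: "'a mat"
  assume a: "1 \<le> m" "1 \<le> n" "\<beta> \<in> carrier_mat m m" "\<beta>' \<in> carrier_mat n n"
  note c = A_MB_D(1)[OF f a(1) a(3)] A_MB_D(1)[OF f a(2) a(4)]
    A_MB_D(1)[OF g a(1) a(3)] A_MB_D(1)[OF g a(2) a(4)]
  show "f (m + n) (mat_dsum \<beta> \<beta>') + g (m + n) (mat_dsum \<beta> \<beta>') =
      mat_dsum (f m \<beta> + g m \<beta>) (f n \<beta>' + g n \<beta>')"
    unfolding A_MB_D(3)[OF f a(2,1,3,4)] A_MB_D(3)[OF g a(2,1,3,4)]
    unfolding mat_dsum_def
    using c by (intro eq_matI) auto
next
  fix n :: nat and \<beta> :: "'a mat" and s t :: "complex mat"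
  assume a: "1 \<le> n" "\<beta> \<in> carrier_mat n n" "s \<in> carrier_mat n n" "t \<in> carrier_mat n n"
    "s * t = 1\<^sub>m n" "t * s = 1\<^sub>m n"
  note c = A_MB_D(1)[OF f a(1) a(2)] A_MB_D(1)[OF g a(1) a(2)]
  show "f n (amplify s * \<beta> * amplify t) + g n (amplify s * \<beta> * amplify t) =
      s * (f n \<beta> + g n \<beta>) * t"
    unfolding A_MB_D(4)[OF f a] A_MB_D(4)[OF g a] using c a(3,4)
    by (simp add: mult_add_distrib_mat[of s n n] add_mult_distrib_mat[of _ n n])
qed (use A_MB_D(1)[OF f] A_MB_D(1)[OF g] in auto)

lemma fam_scale_in_A_MB:
  assumes f: "f \<in> A_MB"
  shows "fam_scale r f \<in> A_MB"
  unfolding fam_scale_def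
proof (rule A_MB_I)
  fix n :: nat assume n: "1 \<le> n"
  show "analytic_level n (\<lambda>\<beta>. r \<cdot>\<^sub>m f n \<beta>)"
  proof (rule analytic_levelI[where g = "\<lambda>i j \<gamma>. r * f n \<gamma> $$ (i, j)"])
    show "\<exists>L. complex_frechet_at n (\<lambda>\<gamma>. r * f n \<gamma> $$ (i, j)) L \<beta>"
      if ij: "i < n" "j < n" "\<beta> \<in> carrier_mat n n" for i j \<beta>
    proof -
      obtain L where L: "complex_frechet_at n (\<lambda>\<gamma>. f n \<gamma> $$ (i, j)) L \<beta>"
        using analytic_levelD[OF A_MB_D(2)[OF f n] ij] by blast
      show ?thesis by (rule exI, rule complex_frechet_mult[OF complex_frechet_const L])
    qed
  next
    show "(r \<cdot>\<^sub>m f n \<gamma>) $$ (i, j) = r * f n \<gamma> $$ (i, j)"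
      if "i < n" "j < n" "\<gamma> \<in> carrier_mat n n" for i j \<gamma>
      using A_MB_D(1)[OF f n that(3)] that by simp
  qed
next
  fix m n :: nat and \<beta> \<beta>' :: "'a mat"
  assume a: "1 \<le> m" "1 \<le> n" "\<beta> \<in> carrier_mat m m" "\<beta>' \<in> carrier_mat n n"
  note c = A_MB_D(1)[OF f a(1) a(3)] A_MB_D(1)[OF f a(2) a(4)]
  show "r \<cdot>\<^sub>m f (m + n) (mat_dsum \<beta> \<beta>') = mat_dsum (r \<cdot>\<^sub>m f m \<beta>) (r \<cdot>\<^sub>m f n \<beta>')"
    unfolding A_MB_D(3)[OF f a(2,1,3,4)]
    unfolding mat_dsum_def
    using c by (intro eq_matI) auto
next
  fix n :: nat and \<beta> :: "'a mat" and s t :: "complex mat"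
  assume a: "1 \<le> n" "\<beta> \<in> carrier_mat n n" "s \<in> carrier_mat n n" "t \<in> carrier_mat n n"
    "s * t = 1\<^sub>m n" "t * s = 1\<^sub>m n"
  show "r \<cdot>\<^sub>m f n (amplify s * \<beta> * amplify t) = s * (r \<cdot>\<^sub>m f n \<beta>) * t"
    unfolding A_MB_D(4)[OF f a] using A_MB_D(1)[OF f a(1) a(2)] a(3,4)
    by (simp add: mult_smult_distrib[of s n n] mult_smult_assoc_mat[of _ n n])
qed (use A_MB_D(1)[OF f] in auto)

lemma fam_mult_in_A_MB:
  assumes f: "f \<in> A_MB" and g: "g \<in> A_MB"
  shows "fam_mult f g \<in> A_MB"
  unfolding fam_mult_def
proof (rule A_MB_I)
  fix n :: nat assume n: "1 \<le> n"
  show "analytic_level n (\<lambda>\<beta>. f n \<beta> * g n \<beta>)"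
  proof (rule analytic_levelI[where
        g = "\<lambda>i j \<gamma>. \<Sum>k<n. f n \<gamma> $$ (i, k) * g n \<gamma> $$ (k, j)"])
    show "\<exists>L. complex_frechet_at n (\<lambda>\<gamma>. \<Sum>k<n. f n \<gamma> $$ (i, k) * g n \<gamma> $$ (k, j)) L \<beta>"
      if ij: "i < n" "j < n" "\<beta> \<in> carrier_mat n n" for i j \<beta>
    proof (rule complex_frechet_sum)
      fix k assume "k \<in> {..<n}"
      hence k: "k < n" by simp
      obtain L1 where 1: "complex_frechet_at n (\<lambda>\<gamma>. f n \<gamma> $$ (i, k)) L1 \<beta>"
        using analytic_levelD[OF A_MB_D(2)[OF f n] ij(1) k ij(3)] by blast
      obtain L2 where 2: "complex_frechet_at n (\<lambda>\<gamma>. g n \<gamma> $$ (k, j)) L2 \<beta>"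
        using analytic_levelD[OF A_MB_D(2)[OF g n] k ij(2,3)] by blast
      show "\<exists>L. complex_frechet_at n (\<lambda>\<gamma>. f n \<gamma> $$ (i, k) * g n \<gamma> $$ (k, j)) L \<beta>"
        by (rule exI, rule complex_frechet_mult[OF 1 2])
    qed simp
  next
    fix i j :: nat and \<gamma> :: "'a mat"
    assume a: "i < n" "j < n" "\<gamma> \<in> carrier_mat n n"
    show "(f n \<gamma> * g n \<gamma>) $$ (i, j) = (\<Sum>k<n. f n \<gamma> $$ (i, k) * g n \<gamma> $$ (k, j))"
      using a A_MB_D(1)[OF f n a(3)] A_MB_D(1)[OF g n a(3)]
      by (simp add: scalar_prod_def atLeast0LessThan)
  qed
next
  fix m n :: nat and \<beta> \<beta>' :: "'a mat"
  assume a: "1 \<le> m" "1 \<le> n" "\<beta> \<in> carrier_mat m m" "\<beta>' \<in> carrier_mat n n"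
  note c = A_MB_D(1)[OF f a(1) a(3)] A_MB_D(1)[OF f a(2) a(4)]
    A_MB_D(1)[OF g a(1) a(3)] A_MB_D(1)[OF g a(2) a(4)]
  show "f (m + n) (mat_dsum \<beta> \<beta>') * g (m + n) (mat_dsum \<beta> \<beta>') = mat_dsum (f m \<beta> * g m \<beta>) (f n \<beta>' * g n \<beta>')"
    unfolding A_MB_D(3)[OF f a(2,1,3,4)] A_MB_D(3)[OF g a(2,1,3,4)]
    unfolding mat_dsum_def
    using c by (subst mult_four_block_mat) auto
next
  fix n :: nat and \<beta> :: "'a mat" and s t :: "complex mat"
  assume a: "1 \<le> n" "\<beta> \<in> carrier_mat n n" "s \<in> carrier_mat n n" "t \<in> carrier_mat n n"
    "s * t = 1\<^sub>m n" "t * s = 1\<^sub>m n"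
  define X where "X = f n \<beta>"
  define Y where "Y = g n \<beta>"
  have c: "X \<in> carrier_mat n n" "Y \<in> carrier_mat n n"
    using A_MB_D(1)[OF f a(1) a(2)] A_MB_D(1)[OF g a(1) a(2)] unfolding X_def Y_def .
  have "(s * X * t) * (s * Y * t) = s * X * (t * s) * (Y * t)"
    using c a(3,4) by (simp add: assoc_mult_mat[of _ n n _ n _ n])
  also have "\<dots> = s * (X * Y) * t"
    using c a by (simp add: assoc_mult_mat[of _ n n _ n _ n])
  finally show "f n (amplify s * \<beta> * amplify t) * g n (amplify s * \<beta> * amplify t) =
      s * (f n \<beta> * g n \<beta>) * t"
    unfolding A_MB_D(4)[OF f a] A_MB_D(4)[OF g a] X_def Y_def .
next
  show "f n \<beta> * g n \<beta> \<in> carrier_mat n n" if "1 \<le> n" "\<beta> \<in> carrier_mat n n" for n \<beta>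
    using A_MB_D(1)[OF f that] A_MB_D(1)[OF g that] by simp
qed

lemma Z_Bd_subset_A_MB: "Z_Bd \<subseteq> A_MB"
proof
  fix f :: "'b::complex_banach_algebra_1 family" assume "f \<in> Z_Bd"
  thus "f \<in> A_MB"
    by induction (auto intro: zfun_in_A_MB fam_one_in_A_MB fam_add_in_A_MB fam_scale_in_A_MB
        fam_mult_in_A_MB)
qed

end

theory Submission
  imports Defs
begin

text \<open>
  Write \<open>X = z(\<theta>)\<close>. Since \<open>\<theta>(1) = 1\<close>, every functional is the sum of a multiple of \<open>\<theta>\<close> and of a
  functional that vanishes at 1, so \<open>Z(B\<^sup>d)\<close> is spanned by the words in letters \<open>\<theta>\<close> and \<open>\<psi>\<close> with
  \<open>\<psi>(1) = 0\<close>. On such words \<open>\<partial>\<close> is the free difference quotient with respect to \<open>X\<close>: it splits a word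
  at each occurrence of \<open>X\<close> (\<open>free_diff_word\<close>). This comes from the Leibniz rule, which holds because
  an element of \<open>Z(B\<^sup>d)\<close> maps a block upper triangular matrix with corner \<open>\<epsilon> e \<otimes> 1\<close> to a block upper
  triangular matrix whose corner is exactly linear in \<open>\<epsilon>\<close> (\<open>Z_Bd_block\<close>).

  If \<open>p = D[q]\<close> with \<open>q\<close> a word, then \<open>\<partial>p\<close> is the sum over ordered pairs of distinct occurrences of
  \<open>X\<close> in the cyclic word \<open>q\<close> of the two arcs that they cut out. Exchanging the two occurrences
  exchanges the arcs, so \<open>\<partial>p\<close> is invariant under the flip (\<open>free_diff_cyclic_deriv_flip\<close>).

  By the Leibniz rule, \<open>D[pX]\<close> and \<open>L\<^sub>\<theta>[p]\<close> differ from \<open>p\<close> by \<open>\<sigma>(\<partial>p) # X\<close> and \<open>\<partial>p # X\<close>, which agree if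
  \<open>\<partial>p\<close> is invariant under the flip (\<open>cyclic_deriv_star_eq_L_op\<close>).

  Finally \<open>L\<^sub>\<theta>\<close> multiplies a word of degree \<open>k\<close> in \<open>X\<close> by \<open>k + 1\<close>. If \<open>p = \<Sum> c\<^sub>w w\<close> satisfies
  \<open>D[pX] = L\<^sub>\<theta>[p]\<close>, compare the two sides degree by degree: \<open>q = \<Sum> c\<^sub>w w X / (deg w + 1)\<close> is a
  primitive of \<open>p\<close> (\<open>ex_cyclic_primitive\<close>). The words need not be known to be linearly independent for
  this: the substitution \<open>\<beta> \<mapsto> \<beta> + (t - 1) \<theta>(\<beta>) \<otimes> 1\<close> multiplies \<open>X\<close> by \<open>t\<close> and fixes the other
  letters, so that the identity at all these points is an identity between polynomials in \<open>t\<close>.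
\<close>

section \<open>The free difference quotient on the algebra generated by the coordinates\<close>

lemma Z_Bd_carrier:
  "f \<in> Z_Bd \<Longrightarrow> 1 \<le> n \<Longrightarrow> \<beta> \<in> carrier_mat n n \<Longrightarrow> f n \<beta> \<in> carrier_mat n n"
  using Z_Bd_subset_A_MB A_MB_D(1) by blast

lemma Z_Bd_restrict: "f \<in> Z_Bd \<Longrightarrow> restrict_family f = f"
  using Z_Bd_subset_A_MB unfolding A_MB_def by blast

lemma family_eqI:
  assumes "restrict_family f = f" "restrict_family g = g"
    and "\<And>n \<beta>. 1 \<le> n \<Longrightarrow> \<beta> \<in> carrier_mat n n \<Longrightarrow> f n \<beta> = g n \<beta>"
  shows "f = g"
proof -
  have "restrict_family f = restrict_family g"
    using assms(3) by (auto simp: restrict_family_def fun_eq_iff)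
  thus ?thesis using assms(1,2) by simp
qed

lemma fam_eval:
  assumes "1 \<le> n" "\<beta> \<in> carrier_mat n n"
  shows "fam_one n \<beta> = 1\<^sub>m n" "fam_add f g n \<beta> = f n \<beta> + g n \<beta>"
    "fam_scale c f n \<beta> = c \<cdot>\<^sub>m f n \<beta>" "fam_mult f g n \<beta> = f n \<beta> * g n \<beta>"
    "zfun \<phi> n \<beta> = map_mat \<phi> \<beta>"
  using assms by (simp_all add: fam_one_def fam_add_def fam_scale_def fam_mult_def zfun_def
      restrict_family_def)

text \<open>
  The matrix on which a family is evaluated in the definition of \<open>\<partial>\<close>.
\<close>

definition block_arg ::
  "nat \<Rightarrow> nat \<Rightarrow> 'b::complex_banach_algebra_1 mat \<Rightarrow> 'b mat \<Rightarrow> nat \<Rightarrow> nat \<Rightarrow> complex \<Rightarrow> 'b mat"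
where
  "block_arg m n \<beta> \<beta>' b c \<epsilon> = four_block_mat \<beta> (scaled_unit m n b c \<epsilon>) (0\<^sub>m n m) \<beta>'"

lemma block_arg_carrier:
  assumes "\<beta> \<in> carrier_mat m m" "\<beta>' \<in> carrier_mat n n"
  shows "block_arg m n \<beta> \<beta>' b c \<epsilon> \<in> carrier_mat (m + n) (m + n)"
  using assms by (simp add: block_arg_def four_block_carrier_mat)

lemma free_diff_outside:
  assumes "1 \<le> m" "1 \<le> n" "\<beta> \<in> carrier_mat m m" "\<beta>' \<in> carrier_mat n n"
    and "\<not> (a < m \<and> b < m \<and> c < n \<and> d < n)"
  shows "free_diff f m n \<beta> \<beta>' a b c d = 0"
  using assms unfolding free_diff_def restrict_bifamily_def tensor_of_def by auto

lemma free_diff_eqI: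
  assumes "1 \<le> m" "1 \<le> n" "\<beta> \<in> carrier_mat m m" "\<beta>' \<in> carrier_mat n n"
    and "a < m" "b < m" "c < n" "d < n"
    and "X \<in> carrier_mat m m" "T \<in> carrier_mat m n" "Y \<in> carrier_mat n n"
    and "\<And>\<epsilon>. f (m + n) (block_arg m n \<beta> \<beta>' b c \<epsilon>) = four_block_mat X (\<epsilon> \<cdot>\<^sub>m T) (0\<^sub>m n m) Y"
  shows "free_diff f m n \<beta> \<beta>' a b c d = T $$ (a, d)"
proof -
  have "(\<lambda>\<epsilon>. f (m + n) (block_arg m n \<beta> \<beta>' b c \<epsilon>) $$ (a, m + d)) = (\<lambda>\<epsilon>. \<epsilon> * T $$ (a, d))"
    using assms by auto
  moreover have "deriv (\<lambda>\<epsilon>. \<epsilon> * T $$ (a, d)) 0 = T $$ (a, d)"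
    by (auto intro!: DERIV_imp_deriv derivative_eq_intros)
  ultimately have "deriv (\<lambda>\<epsilon>. f (m + n) (block_arg m n \<beta> \<beta>' b c \<epsilon>) $$ (a, m + d)) 0 = T $$ (a, d)"
    by simp
  thus ?thesis
    using assms(1-8) by (simp add: free_diff_def restrict_bifamily_def tensor_of_def block_arg_def)
qed

lemma upper_block_mult:
  fixes \<epsilon> :: complex
  assumes "A \<in> carrier_mat m m" "S \<in> carrier_mat m n" "D \<in> carrier_mat n n"
    and "A' \<in> carrier_mat m m" "T \<in> carrier_mat m n" "D' \<in> carrier_mat n n"
  shows "four_block_mat A (\<epsilon> \<cdot>\<^sub>m S) (0\<^sub>m n m) D * four_block_mat A' (\<epsilon> \<cdot>\<^sub>m T) (0\<^sub>m n m) D' =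
    four_block_mat (A * A') (\<epsilon> \<cdot>\<^sub>m (A * T + S * D')) (0\<^sub>m n m) (D * D')"
  using assms
  by (subst mult_four_block_mat[where ?nr1.0 = m and ?n1.0 = m and ?n2.0 = n and ?nr2.0 = n
        and ?nc1.0 = m and ?nc2.0 = n])
    (auto simp: mult_smult_distrib[of _ m m _ n] mult_smult_assoc_mat[of _ m n _ n]
      add_smult_distrib_left_mat[of _ m n])

lemma Z_Bd_block_ex:
  assumes "f \<in> Z_Bd" "1 \<le> m" "1 \<le> n" "\<beta> \<in> carrier_mat m m" "\<beta>' \<in> carrier_mat n n"
  shows "\<exists>T\<in>carrier_mat m n. \<forall>\<epsilon>. f (m + n) (block_arg m n \<beta> \<beta>' b c \<epsilon>) =
           four_block_mat (f m \<beta>) (\<epsilon> \<cdot>\<^sub>m T) (0\<^sub>m n m) (f n \<beta>')"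
proof -
  note mn = assms(2-5)
  note ca = block_arg_carrier[OF assms(4,5), of b c]
  have mn1: "1 \<le> m + n" using assms by simp
  note ev = fam_eval[OF mn1 ca] fam_eval[OF assms(2,4)] fam_eval[OF assms(3,5)]
  show ?thesis
    using assms(1)
  proof induction
    case (zfun \<phi>)
    have "map_mat \<phi> (block_arg m n \<beta> \<beta>' b c \<epsilon>) = four_block_mat (map_mat \<phi> \<beta>)
        (\<epsilon> \<cdot>\<^sub>m Matrix.mat m n (\<lambda>(i, j). if i = b \<and> j = c then \<phi> 1 else 0)) (0\<^sub>m n m) (map_mat \<phi> \<beta>')" for \<epsilon>
      using mn by (intro eq_matI)
        (auto simp: block_arg_def scaled_unit_def dual_zero[OF zfun] dual_scaleC[OF zfun])
    thus ?case unfolding ev by (intro bexI allI) auto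
  next
    case one
    have "1\<^sub>m (m + n) = four_block_mat (1\<^sub>m m) (\<epsilon> \<cdot>\<^sub>m 0\<^sub>m m n) (0\<^sub>m n m) (1\<^sub>m n)" for \<epsilon> :: complex
      by (intro eq_matI) auto
    thus ?case unfolding ev by (intro bexI[of _ "0\<^sub>m m n"] allI) auto
  next
    case (add f g)
    then obtain S T where ST: "S \<in> carrier_mat m n" "T \<in> carrier_mat m n"
      "\<And>\<epsilon>. f (m + n) (block_arg m n \<beta> \<beta>' b c \<epsilon>) = four_block_mat (f m \<beta>) (\<epsilon> \<cdot>\<^sub>m S) (0\<^sub>m n m) (f n \<beta>')"
      "\<And>\<epsilon>. g (m + n) (block_arg m n \<beta> \<beta>' b c \<epsilon>) = four_block_mat (g m \<beta>) (\<epsilon> \<cdot>\<^sub>m T) (0\<^sub>m n m) (g n \<beta>')"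
      by blast
    note cr = Z_Bd_carrier[OF add(1) mn(1,3)] Z_Bd_carrier[OF add(1) mn(2,4)]
      Z_Bd_carrier[OF add(2) mn(1,3)] Z_Bd_carrier[OF add(2) mn(2,4)]
    show ?case unfolding ev ST(3,4)
    proof (intro bexI[of _ "S + T"] allI)
      show "four_block_mat (f m \<beta>) (\<epsilon> \<cdot>\<^sub>m S) (0\<^sub>m n m) (f n \<beta>') +
          four_block_mat (g m \<beta>) (\<epsilon> \<cdot>\<^sub>m T) (0\<^sub>m n m) (g n \<beta>') =
          four_block_mat (f m \<beta> + g m \<beta>) (\<epsilon> \<cdot>\<^sub>m (S + T)) (0\<^sub>m n m) (f n \<beta>' + g n \<beta>')" for \<epsilon>
        using cr ST(1,2) by (intro eq_matI) (auto simp: distrib_left)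
    qed (use ST in auto)
  next
    case (scale f r)
    then obtain S where S: "S \<in> carrier_mat m n"
      "\<And>\<epsilon>. f (m + n) (block_arg m n \<beta> \<beta>' b c \<epsilon>) = four_block_mat (f m \<beta>) (\<epsilon> \<cdot>\<^sub>m S) (0\<^sub>m n m) (f n \<beta>')"
      by blast
    note cr = Z_Bd_carrier[OF scale(1) mn(1,3)] Z_Bd_carrier[OF scale(1) mn(2,4)]
    show ?case unfolding ev S(2)
    proof (intro bexI[of _ "r \<cdot>\<^sub>m S"] allI)
      show "r \<cdot>\<^sub>m four_block_mat (f m \<beta>) (\<epsilon> \<cdot>\<^sub>m S) (0\<^sub>m n m) (f n \<beta>') =
          four_block_mat (r \<cdot>\<^sub>m f m \<beta>) (\<epsilon> \<cdot>\<^sub>m (r \<cdot>\<^sub>m S)) (0\<^sub>m n m) (r \<cdot>\<^sub>m f n \<beta>')" for \<epsilon>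
        using cr S(1) by (intro eq_matI) auto
    qed (use S in auto)
  next
    case (mult f g)
    then obtain S T where ST: "S \<in> carrier_mat m n" "T \<in> carrier_mat m n"
      "\<And>\<epsilon>. f (m + n) (block_arg m n \<beta> \<beta>' b c \<epsilon>) = four_block_mat (f m \<beta>) (\<epsilon> \<cdot>\<^sub>m S) (0\<^sub>m n m) (f n \<beta>')"
      "\<And>\<epsilon>. g (m + n) (block_arg m n \<beta> \<beta>' b c \<epsilon>) = four_block_mat (g m \<beta>) (\<epsilon> \<cdot>\<^sub>m T) (0\<^sub>m n m) (g n \<beta>')"
      by blast
    note cr = Z_Bd_carrier[OF mult(1) mn(1,3)] Z_Bd_carrier[OF mult(1) mn(2,4)]
      Z_Bd_carrier[OF mult(2) mn(1,3)] Z_Bd_carrier[OF mult(2) mn(2,4)]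
    show ?case unfolding ev ST(3,4)
    proof (intro bexI[of _ "f m \<beta> * T + S * g n \<beta>'"] allI)
      show "four_block_mat (f m \<beta>) (\<epsilon> \<cdot>\<^sub>m S) (0\<^sub>m n m) (f n \<beta>') *
          four_block_mat (g m \<beta>) (\<epsilon> \<cdot>\<^sub>m T) (0\<^sub>m n m) (g n \<beta>') =
          four_block_mat (f m \<beta> * g m \<beta>) (\<epsilon> \<cdot>\<^sub>m (f m \<beta> * T + S * g n \<beta>')) (0\<^sub>m n m)
            (f n \<beta>' * g n \<beta>')" for \<epsilon>
        by (rule upper_block_mult) (use cr ST(1,2) in auto)
    qed (use ST cr in auto)
  qed
qed

text \<open>
  For an element of \<open>Z(B\<^sup>d)\<close> the corner block is exactly linear in \<open>\<epsilon>\<close>, with slope the free difference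
  quotient, so the algebraic rules for \<open>\<partial>\<close> below need no calculus.
\<close>

lemma Z_Bd_block:
  assumes "f \<in> Z_Bd" "1 \<le> m" "1 \<le> n" "\<beta> \<in> carrier_mat m m" "\<beta>' \<in> carrier_mat n n" "b < m" "c < n"
  shows "f (m + n) (block_arg m n \<beta> \<beta>' b c \<epsilon>) = four_block_mat (f m \<beta>)
    (\<epsilon> \<cdot>\<^sub>m Matrix.mat m n (\<lambda>(a, d). free_diff f m n \<beta> \<beta>' a b c d)) (0\<^sub>m n m) (f n \<beta>')"
proof -
  obtain T where T: "T \<in> carrier_mat m n" "\<And>\<epsilon>. f (m + n) (block_arg m n \<beta> \<beta>' b c \<epsilon>) =
      four_block_mat (f m \<beta>) (\<epsilon> \<cdot>\<^sub>m T) (0\<^sub>m n m) (f n \<beta>')"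
    using Z_Bd_block_ex[OF assms(1-5)] by blast
  note cr = Z_Bd_carrier[OF assms(1,2,4)] Z_Bd_carrier[OF assms(1,3,5)]
  have "Matrix.mat m n (\<lambda>(a, d). free_diff f m n \<beta> \<beta>' a b c d) = T"
    using T(1) free_diff_eqI[where f = f, OF assms(2-5) _ assms(6,7) _ cr(1) T(1) cr(2) T(2)]
    by (intro eq_matI) auto
  thus ?thesis using T(2) by simp
qed

lemma free_diff_one:
  assumes "1 \<le> m" "1 \<le> n" "\<beta> \<in> carrier_mat m m" "\<beta>' \<in> carrier_mat n n"
  shows "free_diff fam_one m n \<beta> \<beta>' a b c d = 0"
proof (cases "a < m \<and> b < m \<and> c < n \<and> d < n")
  case True
  have "fam_one (m + n) (block_arg m n \<beta> \<beta>' b c \<epsilon>) =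
      four_block_mat (1\<^sub>m m) (\<epsilon> \<cdot>\<^sub>m 0\<^sub>m m n) (0\<^sub>m n m) (1\<^sub>m n)" for \<epsilon>
    using assms(1) by (subst fam_eval[OF _ block_arg_carrier[OF assms(3,4)]]) (auto intro!: eq_matI)
  from free_diff_eqI[where f = fam_one, OF assms _ _ _ _ _ _ _ this] True show ?thesis by simp
qed (use free_diff_outside[OF assms] in blast)

lemma free_diff_add:
  assumes "f \<in> Z_Bd" "g \<in> Z_Bd"
    and "1 \<le> m" "1 \<le> n" "\<beta> \<in> carrier_mat m m" "\<beta>' \<in> carrier_mat n n"
  shows "free_diff (fam_add f g) m n \<beta> \<beta>' a b c d =
    free_diff f m n \<beta> \<beta>' a b c d + free_diff g m n \<beta> \<beta>' a b c d"
proof (cases "a < m \<and> b < m \<and> c < n \<and> d < n")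
  case True
  let ?T = "\<lambda>f. Matrix.mat m n (\<lambda>(a, d). free_diff f m n \<beta> \<beta>' a b c d)"
  note mn = assms(3-6)
  note cr = Z_Bd_carrier[OF assms(1) mn(1,3)] Z_Bd_carrier[OF assms(1) mn(2,4)]
    Z_Bd_carrier[OF assms(2) mn(1,3)] Z_Bd_carrier[OF assms(2) mn(2,4)]
  have bl: "fam_add f g (m + n) (block_arg m n \<beta> \<beta>' b c \<epsilon>) = four_block_mat (f m \<beta> + g m \<beta>)
      (\<epsilon> \<cdot>\<^sub>m (?T f + ?T g)) (0\<^sub>m n m) (f n \<beta>' + g n \<beta>')" for \<epsilon>
    using mn(1) True cr
    by (subst fam_eval[OF _ block_arg_carrier[OF mn(3,4)]])
      (auto simp: Z_Bd_block assms distrib_left intro!: eq_matI)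
  from free_diff_eqI[where f = "fam_add f g", OF mn _ _ _ _ _ _ _ bl] True cr show ?thesis by simp
qed (use free_diff_outside[OF assms(3-6)] in force)

lemma free_diff_scale:
  assumes "f \<in> Z_Bd"
    and "1 \<le> m" "1 \<le> n" "\<beta> \<in> carrier_mat m m" "\<beta>' \<in> carrier_mat n n"
  shows "free_diff (fam_scale r f) m n \<beta> \<beta>' a b c d = r * free_diff f m n \<beta> \<beta>' a b c d"
proof (cases "a < m \<and> b < m \<and> c < n \<and> d < n")
  case True
  let ?T = "\<lambda>f. Matrix.mat m n (\<lambda>(a, d). free_diff f m n \<beta> \<beta>' a b c d)"
  note mn = assms(2-5)
  note cr = Z_Bd_carrier[OF assms(1) mn(1,3)] Z_Bd_carrier[OF assms(1) mn(2,4)]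
  have bl: "fam_scale r f (m + n) (block_arg m n \<beta> \<beta>' b c \<epsilon>) = four_block_mat (r \<cdot>\<^sub>m f m \<beta>)
      (\<epsilon> \<cdot>\<^sub>m (r \<cdot>\<^sub>m ?T f)) (0\<^sub>m n m) (r \<cdot>\<^sub>m f n \<beta>')" for \<epsilon>
    using mn(1) True cr
    by (subst fam_eval[OF _ block_arg_carrier[OF mn(3,4)]])
      (auto simp: Z_Bd_block assms intro!: eq_matI)
  from free_diff_eqI[where f = "fam_scale r f", OF mn _ _ _ _ _ _ _ bl] True cr show ?thesis by simp
qed (use free_diff_outside[OF assms(2-5)] in force)

lemma free_diff_mult:
  assumes "f \<in> Z_Bd" "g \<in> Z_Bd"
    and "1 \<le> m" "1 \<le> n" "\<beta> \<in> carrier_mat m m" "\<beta>' \<in> carrier_mat n n"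
    and "a < m" "b < m" "c < n" "d < n"
  shows "free_diff (fam_mult f g) m n \<beta> \<beta>' a b c d =
    (\<Sum>e<m. f m \<beta> $$ (a, e) * free_diff g m n \<beta> \<beta>' e b c d) +
    (\<Sum>e<n. free_diff f m n \<beta> \<beta>' a b c e * g n \<beta>' $$ (e, d))"
proof -
  let ?T = "\<lambda>f. Matrix.mat m n (\<lambda>(a, d). free_diff f m n \<beta> \<beta>' a b c d)"
  note mn = assms(3-6)
  note cr = Z_Bd_carrier[OF assms(1) mn(1,3)] Z_Bd_carrier[OF assms(1) mn(2,4)]
    Z_Bd_carrier[OF assms(2) mn(1,3)] Z_Bd_carrier[OF assms(2) mn(2,4)]
  have "four_block_mat (f m \<beta>) (\<epsilon> \<cdot>\<^sub>m ?T f) (0\<^sub>m n m) (f n \<beta>') *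
      four_block_mat (g m \<beta>) (\<epsilon> \<cdot>\<^sub>m ?T g) (0\<^sub>m n m) (g n \<beta>') =
      four_block_mat (f m \<beta> * g m \<beta>) (\<epsilon> \<cdot>\<^sub>m (f m \<beta> * ?T g + ?T f * g n \<beta>')) (0\<^sub>m n m)
        (f n \<beta>' * g n \<beta>')" for \<epsilon>
    by (rule upper_block_mult) (use cr in auto)
  hence bl: "fam_mult f g (m + n) (block_arg m n \<beta> \<beta>' b c \<epsilon>) = four_block_mat (f m \<beta> * g m \<beta>)
      (\<epsilon> \<cdot>\<^sub>m (f m \<beta> * ?T g + ?T f * g n \<beta>')) (0\<^sub>m n m) (f n \<beta>' * g n \<beta>')" for \<epsilon>
    using mn(1) assms
    by (subst fam_eval[OF _ block_arg_carrier[OF mn(3,4)]]) (auto simp: Z_Bd_block)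
  have "free_diff (fam_mult f g) m n \<beta> \<beta>' a b c d = (f m \<beta> * ?T g + ?T f * g n \<beta>') $$ (a, d)"
    by (rule free_diff_eqI[where f = "fam_mult f g", OF mn _ _ _ _ _ _ _ bl]) (use assms cr in auto)
  also have "\<dots> = (f m \<beta> * ?T g) $$ (a, d) + (?T f * g n \<beta>') $$ (a, d)"
    using cr assms by auto
  finally show ?thesis
    using cr assms by (simp add: scalar_prod_def atLeast0LessThan)
qed


section \<open>Words in the coordinates\<close>

text \<open>
  The product \<open>z(\<phi>\<^sub>1) \<dots> z(\<phi>\<^sub>k)\<close> of a word of functionals; no condition on the letters is imposed here.
\<close>

fun fam_word :: "('b::complex_banach_algebra_1 \<Rightarrow> complex) list \<Rightarrow> 'b family" where
  "fam_word [] = fam_one"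
| "fam_word (\<phi> # w) = fam_mult (zfun \<phi>) (fam_word w)"

lemma fam_word_carrier:
  assumes "1 \<le> n" "\<beta> \<in> carrier_mat n n"
  shows "fam_word w n \<beta> \<in> carrier_mat n n"
  using assms by (induction w) (simp_all add: fam_eval)

lemma fam_word_in_Z_Bd: "set w \<subseteq> topological_dual \<Longrightarrow> fam_word w \<in> Z_Bd"
  by (induction w) (auto intro: Z_Bd.intros)

lemma fam_word_append:
  assumes "1 \<le> n" "\<beta> \<in> carrier_mat n n"
  shows "fam_word (u @ v) n \<beta> = fam_word u n \<beta> * fam_word v n \<beta>"
proof (induction u)
  case Nil
  show ?case using left_mult_one_mat[OF fam_word_carrier[OF assms]] assms by (simp add: fam_eval)
next
  case (Cons \<phi> u)
  show ?case
    using Cons assms fam_word_carrier[OF assms]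
    by (simp add: fam_eval assoc_mult_mat[of _ n n _ n _ n])
qed

lemma free_diff_word:
  assumes "set w \<subseteq> topological_dual"
    and "1 \<le> m" "1 \<le> n" "\<beta> \<in> carrier_mat m m" "\<beta>' \<in> carrier_mat n n"
    and "a < m" "b < m" "c < n" "d < n"
  shows "free_diff (fam_word w) m n \<beta> \<beta>' a b c d =
    (\<Sum>i<length w. (w ! i) 1 *
      (fam_word (take i w) m \<beta> $$ (a, b) * fam_word (drop (Suc i) w) n \<beta>' $$ (c, d)))"
  using assms(1) assms(6)
proof (induction w arbitrary: a)
  case Nil
  show ?case using free_diff_one[OF assms(2-5)] by simp
next
  case (Cons \<phi> w)
  have \<phi>: "\<phi> \<in> topological_dual" and w: "set w \<subseteq> topological_dual" using Cons.prems by auto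
  note mn = assms(2-5)
  note cw = fam_word_carrier[OF mn(1,3)]
  have 1: "free_diff (zfun \<phi>) m n \<beta> \<beta>' a b c e = (if a = b \<and> c = e then \<phi> 1 else 0)" if "e < n" for e
    using mn Cons.prems assms(7-9) that
    by (simp add: free_diff_zfun[OF \<phi>] bifam_scale_def restrict_bifamily_def fam_tensor_def
        pure_tensor_def tensor_of_def fam_eval)
  have "(\<Sum>e<n. free_diff (zfun \<phi>) m n \<beta> \<beta>' a b c e * fam_word w n \<beta>' $$ (e, d)) =
      (\<Sum>e<n. if e = c then (if a = b then \<phi> 1 else 0) * fam_word w n \<beta>' $$ (c, d) else 0)"
    by (rule sum.cong) (auto simp: 1)
  also have "\<dots> = \<phi> 1 * (fam_one m \<beta> $$ (a, b) * fam_word w n \<beta>' $$ (c, d))"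
    using assms mn Cons.prems(2) by (simp add: fam_eval)
  finally have right: "(\<Sum>e<n. free_diff (zfun \<phi>) m n \<beta> \<beta>' a b c e * fam_word w n \<beta>' $$ (e, d)) = \<dots>" .
  have "(\<Sum>e<m. zfun \<phi> m \<beta> $$ (a, e) * free_diff (fam_word w) m n \<beta> \<beta>' e b c d) =
      (\<Sum>e<m. \<Sum>i<length w. zfun \<phi> m \<beta> $$ (a, e) * ((w ! i) 1 *
        (fam_word (take i w) m \<beta> $$ (e, b) * fam_word (drop (Suc i) w) n \<beta>' $$ (c, d))))"
    by (rule sum.cong) (auto simp: Cons.IH[OF w] sum_distrib_left)
  also have "\<dots> = (\<Sum>i<length w. \<Sum>e<m. zfun \<phi> m \<beta> $$ (a, e) * ((w ! i) 1 *
        (fam_word (take i w) m \<beta> $$ (e, b) * fam_word (drop (Suc i) w) n \<beta>' $$ (c, d))))"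
    by (rule sum.swap)
  also have "\<dots> = (\<Sum>i<length w. (w ! i) 1 *
      (fam_word (\<phi> # take i w) m \<beta> $$ (a, b) * fam_word (drop (Suc i) w) n \<beta>' $$ (c, d)))"
  proof (rule sum.cong[OF refl])
    fix i
    have "fam_word (\<phi> # take i w) m \<beta> $$ (a, b) =
        (\<Sum>e<m. zfun \<phi> m \<beta> $$ (a, e) * fam_word (take i w) m \<beta> $$ (e, b))"
      using cw[of "take i w"] mn Cons.prems(2) assms(7)
      by (simp add: fam_eval scalar_prod_def atLeast0LessThan)
    thus "(\<Sum>e<m. zfun \<phi> m \<beta> $$ (a, e) * ((w ! i) 1 *
        (fam_word (take i w) m \<beta> $$ (e, b) * fam_word (drop (Suc i) w) n \<beta>' $$ (c, d)))) =
      (w ! i) 1 * (fam_word (\<phi> # take i w) m \<beta> $$ (a, b) * fam_word (drop (Suc i) w) n \<beta>' $$ (c, d))"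
      by (simp add: sum_distrib_left sum_distrib_right mult_ac)
  qed
  finally have left: "(\<Sum>e<m. zfun \<phi> m \<beta> $$ (a, e) * free_diff (fam_word w) m n \<beta> \<beta>' e b c d) = \<dots>" .
  have "free_diff (fam_word (\<phi> # w)) m n \<beta> \<beta>' a b c d =
      (\<Sum>e<m. zfun \<phi> m \<beta> $$ (a, e) * free_diff (fam_word w) m n \<beta> \<beta>' e b c d) +
      (\<Sum>e<n. free_diff (zfun \<phi>) m n \<beta> \<beta>' a b c e * fam_word w n \<beta>' $$ (e, d))"
    unfolding fam_word.simps
    by (rule free_diff_mult[OF Z_Bd.zfun[OF \<phi>] fam_word_in_Z_Bd[OF w] mn Cons.prems(2) assms(7-9)])
  thus ?case unfolding left right by (simp add: sum.lessThan_Suc_shift del: sum.lessThan_Suc)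
qed

text \<open>
  Linear combinations of words, given by a list of coefficients and words. A word may occur several
  times in the list.
\<close>

fun word_sum :: "(complex \<times> ('b::complex_banach_algebra_1 \<Rightarrow> complex) list) list \<Rightarrow> 'b family" where
  "word_sum [] = fam_scale 0 fam_one"
| "word_sum ((c, w) # xs) = fam_add (fam_scale c (fam_word w)) (word_sum xs)"

text \<open>
  All letters that occur in the list lie in \<open>A\<close>.
\<close>

definition words_over :: "'a set \<Rightarrow> ('c \<times> 'a list) list \<Rightarrow> bool" where
  "words_over A xs \<longleftrightarrow> (\<forall>(c, w)\<in>set xs. set w \<subseteq> A)"

lemma word_sum_in_Z_Bd: "words_over topological_dual xs \<Longrightarrow> word_sum xs \<in> Z_Bd"
  by (induction xs rule: word_sum.induct)
    (auto simp: words_over_def intro!: Z_Bd.intros fam_word_in_Z_Bd)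

lemma restrict_word_sum: "restrict_family (word_sum xs) = word_sum xs"
  by (induction xs rule: word_sum.induct)
    (auto simp: fam_scale_def fam_add_def restrict_family_def fun_eq_iff)

lemma word_sum_carrier:
  assumes "1 \<le> n" "\<beta> \<in> carrier_mat n n"
  shows "word_sum xs n \<beta> \<in> carrier_mat n n"
  using assms fam_word_carrier[OF assms]
  by (induction xs rule: word_sum.induct) (simp_all add: fam_eval)

lemma word_sum_entry:
  assumes "1 \<le> n" "\<beta> \<in> carrier_mat n n" "i < n" "j < n"
  shows "word_sum xs n \<beta> $$ (i, j) = (\<Sum>(c, w)\<leftarrow>xs. c * fam_word w n \<beta> $$ (i, j))"
  using assms carrier_matD[OF fam_word_carrier[OF assms(1,2)]]
    carrier_matD[OF word_sum_carrier[OF assms(1,2)]]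
  by (induction xs rule: word_sum.induct) (auto simp: fam_eval)

lemma free_diff_word_sum:
  assumes "words_over topological_dual xs"
    and "1 \<le> m" "1 \<le> n" "\<beta> \<in> carrier_mat m m" "\<beta>' \<in> carrier_mat n n"
  shows "free_diff (word_sum xs) m n \<beta> \<beta>' a b c d =
    (\<Sum>(r, w)\<leftarrow>xs. r * free_diff (fam_word w) m n \<beta> \<beta>' a b c d)"
  using assms(1)
proof (induction xs rule: word_sum.induct)
  case 1
  show ?case using free_diff_scale[OF Z_Bd.one assms(2-5)] by simp
next
  case (2 r w xs)
  have w: "set w \<subseteq> topological_dual" and xs: "words_over topological_dual xs"
    using "2.prems" by (auto simp: words_over_def)
  show ?case
    using "2.IH"[OF xs] fam_word_in_Z_Bd[OF w] word_sum_in_Z_Bd[OF xs]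
    by (simp add: free_diff_add[OF _ _ assms(2-5)] free_diff_scale[OF _ assms(2-5)] Z_Bd.scale)
qed

lemma word_sum_eqI:
  assumes "restrict_family f = f"
    and "\<And>n \<beta>. 1 \<le> n \<Longrightarrow> \<beta> \<in> carrier_mat n n \<Longrightarrow> f n \<beta> \<in> carrier_mat n n"
    and "\<And>n \<beta> i j. 1 \<le> n \<Longrightarrow> \<beta> \<in> carrier_mat n n \<Longrightarrow> i < n \<Longrightarrow> j < n \<Longrightarrow>
      f n \<beta> $$ (i, j) = (\<Sum>(c, w)\<leftarrow>xs. c * fam_word w n \<beta> $$ (i, j))"
  shows "f = word_sum xs"
proof (rule family_eqI[OF assms(1) restrict_word_sum])
  fix n :: nat and \<beta> :: "'a mat" assume n: "1 \<le> n" "\<beta> \<in> carrier_mat n n"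
  show "f n \<beta> = word_sum xs n \<beta>"
    using assms(2)[OF n] word_sum_carrier[OF n, of xs] word_sum_entry[OF n, of _ _ xs] assms(3)[OF n]
    by (intro eq_matI) auto
qed

lemma restrict_fam_ops:
  "restrict_family (fam_add f g) = fam_add f g" "restrict_family (fam_scale r f) = fam_scale r f"
  "restrict_family (fam_mult f g) = fam_mult f g"
  by (auto simp: fam_add_def fam_scale_def fam_mult_def restrict_family_def fun_eq_iff)

lemma sum_list_sum_swap: "(\<Sum>x\<leftarrow>xs. \<Sum>i\<in>I. f x i) = (\<Sum>i\<in>I. \<Sum>x\<leftarrow>xs. (f x i :: complex))"
  by (induction xs) (simp_all add: sum.distrib)

lemma fam_add_word_sum: "fam_add (word_sum xs) (word_sum ys) = word_sum (xs @ ys)"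
proof (rule word_sum_eqI[OF restrict_fam_ops(1)])
  fix n :: nat and \<beta> :: "'a mat" assume n: "1 \<le> n" "\<beta> \<in> carrier_mat n n"
  note cr = word_sum_carrier[OF n]
  show "fam_add (word_sum xs) (word_sum ys) n \<beta> \<in> carrier_mat n n"
    using cr by (simp add: fam_eval[OF n])
  show "fam_add (word_sum xs) (word_sum ys) n \<beta> $$ (i, j) =
      (\<Sum>(c, w)\<leftarrow>xs @ ys. c * fam_word w n \<beta> $$ (i, j))" if "i < n" "j < n" for i j
    using cr[of ys] that by (simp add: fam_eval[OF n] word_sum_entry[OF n that])
qed

lemma fam_scale_word_sum: "fam_scale r (word_sum xs) = word_sum (map (\<lambda>(c, w). (r * c, w)) xs)"
proof (rule word_sum_eqI[OF restrict_fam_ops(2)])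
  fix n :: nat and \<beta> :: "'a mat" assume n: "1 \<le> n" "\<beta> \<in> carrier_mat n n"
  note cr = word_sum_carrier[OF n]
  show "fam_scale r (word_sum xs) n \<beta> \<in> carrier_mat n n"
    using cr by (simp add: fam_eval[OF n])
  show "fam_scale r (word_sum xs) n \<beta> $$ (i, j) =
      (\<Sum>(c, w)\<leftarrow>map (\<lambda>(c, w). (r * c, w)) xs. c * fam_word w n \<beta> $$ (i, j))" if "i < n" "j < n" for i j
  proof -
    have "(\<Sum>(c, w)\<leftarrow>map (\<lambda>(c, w). (r * c, w)) xs. c * fam_word w n \<beta> $$ (i, j)) =
        r * (\<Sum>(c, w)\<leftarrow>xs. c * fam_word w n \<beta> $$ (i, j))"
      by (induction xs) (auto simp: algebra_simps)
    thus ?thesis using cr[of xs] that by (simp add: fam_eval[OF n] word_sum_entry[OF n that])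
  qed
qed

lemma fam_mult_word_sum:
  "fam_mult (word_sum xs) (word_sum ys) =
    word_sum (concat (map (\<lambda>(c, u). map (\<lambda>(d, v). (c * d, u @ v)) ys) xs))"
proof (rule word_sum_eqI[OF restrict_fam_ops(3)])
  fix n :: nat and \<beta> :: "'a mat" assume n: "1 \<le> n" "\<beta> \<in> carrier_mat n n"
  note cr = word_sum_carrier[OF n] fam_word_carrier[OF n]
  show "fam_mult (word_sum xs) (word_sum ys) n \<beta> \<in> carrier_mat n n"
    using mult_carrier_mat[OF cr(1) cr(1)] by (simp add: fam_eval[OF n])
  fix i j assume ij: "i < n" "j < n"
  have app: "fam_word (u @ v) n \<beta> $$ (i, j) =
      (\<Sum>k<n. fam_word u n \<beta> $$ (i, k) * fam_word v n \<beta> $$ (k, j))" for u v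
    using cr(2)[of u] cr(2)[of v] ij
    by (simp add: fam_word_append[OF n] scalar_prod_def atLeast0LessThan)
  have "fam_mult (word_sum xs) (word_sum ys) n \<beta> $$ (i, j) =
      (\<Sum>k<n. word_sum xs n \<beta> $$ (i, k) * word_sum ys n \<beta> $$ (k, j))"
    using cr(1)[of xs] cr(1)[of ys] ij by (simp add: fam_eval[OF n] scalar_prod_def atLeast0LessThan)
  also have "\<dots> = (\<Sum>k<n. \<Sum>(c, u)\<leftarrow>xs. \<Sum>(d, v)\<leftarrow>ys.
      c * d * (fam_word u n \<beta> $$ (i, k) * fam_word v n \<beta> $$ (k, j)))"
    using ij by (intro sum.cong) (auto simp: word_sum_entry[OF n] split_def mult_ac
        simp flip: sum_list_const_mult sum_list_mult_const)
  also have "\<dots> = (\<Sum>(c, u)\<leftarrow>xs. \<Sum>(d, v)\<leftarrow>ys. c * d * fam_word (u @ v) n \<beta> $$ (i, j))"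
    by (simp add: app split_def sum_distrib_left flip: sum_list_sum_swap)
  also have "\<dots> = (\<Sum>(c, w)\<leftarrow>concat (map (\<lambda>(c, u). map (\<lambda>(d, v). (c * d, u @ v)) ys) xs).
      c * fam_word w n \<beta> $$ (i, j))"
    by (induction xs) (auto simp: split_def o_def)
  finally show "fam_mult (word_sum xs) (word_sum ys) n \<beta> $$ (i, j) = \<dots>" .
qed

text \<open>
  The letters for which the number of occurrences of \<open>\<theta>\<close> is a grading: \<open>\<theta>\<close> itself, of degree 1, and
  the functionals that vanish at 1, of degree 0.
\<close>

definition graded_letters ::
  "('b::complex_banach_algebra_1 \<Rightarrow> complex) \<Rightarrow> ('b \<Rightarrow> complex) set"
where
  "graded_letters \<theta> = {\<phi>\<in>topological_dual. \<phi> = \<theta> \<or> \<phi> 1 = 0}"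

lemma Z_Bd_word_sum:
  assumes \<theta>: "\<theta> \<in> topological_dual" "\<theta> 1 = 1" and "p \<in> Z_Bd"
  shows "\<exists>xs. words_over (graded_letters \<theta>) xs \<and> p = word_sum xs"
  using assms(3)
proof induction
  case (zfun \<phi>)
  \<comment> \<open>Splitting off the multiple \<open>\<phi>(1) \<theta>\<close> leaves a functional that vanishes at 1.\<close>
  define \<psi> where "\<psi> = (\<lambda>x. \<phi> x - \<phi> 1 * \<theta> x)"
  have "bounded_linear \<psi>"
    using zfun \<theta> unfolding \<psi>_def topological_dual_def
    by (auto intro!: bounded_linear_sub bounded_linear_const_mult)
  hence \<psi>: "\<psi> \<in> topological_dual" "\<psi> 1 = 0"
    using zfun \<theta> by (auto simp: topological_dual_def \<psi>_def algebra_simps)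
  have "zfun \<phi> = word_sum [(\<phi> 1, [\<theta>]), (1, [\<psi>])]"
  proof (rule word_sum_eqI)
    show "restrict_family (zfun \<phi>) = zfun \<phi>" by (rule Z_Bd_restrict[OF Z_Bd.zfun[OF zfun]])
  qed (auto simp: fam_eval \<psi>_def)
  thus ?case using \<theta> \<psi>
    by (intro exI[of _ "[(\<phi> 1, [\<theta>]), (1, [\<psi>])]"] conjI) (auto simp: words_over_def graded_letters_def)
next
  case one
  have "fam_one = word_sum [(1, [])]"
    by (rule word_sum_eqI[OF Z_Bd_restrict[OF Z_Bd.one]]) (auto simp: fam_eval)
  thus ?case by (intro exI[of _ "[(1, [])]"] conjI) (auto simp: words_over_def)
next
  case (add f g)
  then obtain xs ys where "words_over (graded_letters \<theta>) (xs @ ys)" "f = word_sum xs" "g = word_sum ys"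
    unfolding words_over_def by (metis UnE set_append)
  thus ?case using fam_add_word_sum by blast
next
  case (scale f r)
  then obtain xs where "words_over (graded_letters \<theta>) xs" "f = word_sum xs" by blast
  thus ?case
    by (intro exI[of _ "map (\<lambda>(c, w). (r * c, w)) xs"] conjI)
      (auto simp: fam_scale_word_sum words_over_def)
next
  case (mult f g)
  then obtain xs ys where "words_over (graded_letters \<theta>) xs" "words_over (graded_letters \<theta>) ys"
    "f = word_sum xs" "g = word_sum ys" by blast
  thus ?case
    by (intro exI[of _ "concat (map (\<lambda>(c, u). map (\<lambda>(d, v). (c * d, u @ v)) ys) xs)"] conjI)
      (fastforce simp: fam_mult_word_sum words_over_def)+
qed


section \<open>Cyclic derivatives of words are invariant under the flip\<close>

lemma cyclic_deriv_entry:
  assumes "1 \<le> n" "\<beta> \<in> carrier_mat n n" "a < n" "d < n"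
  shows "cyclic_deriv f n \<beta> $$ (a, d) = (\<Sum>b<n. free_diff f n n \<beta> \<beta> b d a b)"
  using assms by (simp add: cyclic_deriv_def restrict_family_def tensor_mult_def tensor_flip_def)

lemma cyclic_deriv_carrier:
  "1 \<le> n \<Longrightarrow> \<beta> \<in> carrier_mat n n \<Longrightarrow> cyclic_deriv f n \<beta> \<in> carrier_mat n n"
  by (simp add: cyclic_deriv_def restrict_family_def tensor_mult_def)

lemma restrict_cyclic_deriv: "restrict_family (cyclic_deriv f) = cyclic_deriv f"
  by (auto simp: cyclic_deriv_def restrict_family_def fun_eq_iff)

lemma cyclic_deriv_word:
  assumes "set w \<subseteq> topological_dual" "1 \<le> n" "\<beta> \<in> carrier_mat n n" "a < n" "d < n"
  shows "cyclic_deriv (fam_word w) n \<beta> $$ (a, d) =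
    (\<Sum>i<length w. (w ! i) 1 * fam_word (drop (Suc i) w @ take i w) n \<beta> $$ (a, d))"
proof -
  note cr = carrier_matD[OF fam_word_carrier[OF assms(2,3)]]
  have "cyclic_deriv (fam_word w) n \<beta> $$ (a, d) = (\<Sum>b<n. \<Sum>i<length w. (w ! i) 1 *
      (fam_word (take i w) n \<beta> $$ (b, d) * fam_word (drop (Suc i) w) n \<beta> $$ (a, b)))"
    unfolding cyclic_deriv_entry[OF assms(2-)]
    using assms by (intro sum.cong) (auto simp: free_diff_word)
  also have "\<dots> = (\<Sum>i<length w. \<Sum>b<n. (w ! i) 1 *
      (fam_word (take i w) n \<beta> $$ (b, d) * fam_word (drop (Suc i) w) n \<beta> $$ (a, b)))"
    by (rule sum.swap)
  also have "\<dots> = (\<Sum>i<length w. (w ! i) 1 * fam_word (drop (Suc i) w @ take i w) n \<beta> $$ (a, d))"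
    using assms cr
    by (intro sum.cong)
      (auto simp: fam_word_append scalar_prod_def atLeast0LessThan sum_distrib_left mult_ac)
  finally show ?thesis .
qed

lemma cyclic_deriv_word_sum_entry:
  assumes "words_over topological_dual xs" "1 \<le> n" "\<beta> \<in> carrier_mat n n" "a < n" "d < n"
  shows "cyclic_deriv (word_sum xs) n \<beta> $$ (a, d) =
    (\<Sum>(c, w)\<leftarrow>xs. c * cyclic_deriv (fam_word w) n \<beta> $$ (a, d))"
  using assms
  by (simp add: cyclic_deriv_entry free_diff_word_sum split_def sum_distrib_left flip: sum_list_sum_swap)

text \<open>
  The words in the cyclic derivative of a linear combination of words: each letter \<open>\<phi>\<close> is removed in
  turn, with weight \<open>\<phi>(1)\<close>, and the remaining letters are read cyclically from its successor on.
\<close>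

definition rotations ::
  "(complex \<times> ('b::complex_banach_algebra_1 \<Rightarrow> complex) list) list \<Rightarrow>
   (complex \<times> ('b \<Rightarrow> complex) list) list"
where
  "rotations xs = concat (map (\<lambda>(c, w). map (\<lambda>i. (c * (w ! i) 1, drop (Suc i) w @ take i w))
     [0..<length w]) xs)"

lemma words_over_rotations: "words_over A xs \<Longrightarrow> words_over A (rotations xs)"
  by (fastforce simp: words_over_def rotations_def dest: in_set_takeD in_set_dropD)

lemma sum_rotations:
  "(\<Sum>(c, w)\<leftarrow>rotations xs. c * F w) =
    (\<Sum>(c, w)\<leftarrow>xs. c * (\<Sum>i<length w. (w ! i) 1 * F (drop (Suc i) w @ take i w)))"
  for F :: "_ \<Rightarrow> complex"
  by (induction xs)
    (auto simp: rotations_def o_def interv_sum_list_conv_sum_set_nat atLeast0LessThan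
      sum_distrib_left mult.assoc)

lemma cyclic_deriv_word_sum:
  assumes "words_over topological_dual xs"
  shows "cyclic_deriv (word_sum xs) = word_sum (rotations xs)"
proof (rule word_sum_eqI[OF restrict_cyclic_deriv cyclic_deriv_carrier])
  fix n :: nat and \<beta> :: "'a mat" and a d assume n: "1 \<le> n" "\<beta> \<in> carrier_mat n n" "a < n" "d < n"
  have "cyclic_deriv (word_sum xs) n \<beta> $$ (a, d) = (\<Sum>(c, w)\<leftarrow>xs. c *
      (\<Sum>i<length w. (w ! i) 1 * fam_word (drop (Suc i) w @ take i w) n \<beta> $$ (a, d)))"
    unfolding cyclic_deriv_word_sum_entry[OF assms n]
    using assms by (intro arg_cong[where f = sum_list] map_cong)
      (auto simp: words_over_def cyclic_deriv_word[OF _ n])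
  also have "\<dots> = (\<Sum>(c, w)\<leftarrow>rotations xs. c * fam_word w n \<beta> $$ (a, d))"
    by (rule sum_rotations[symmetric])
  finally show "cyclic_deriv (word_sum xs) n \<beta> $$ (a, d) = \<dots>" .
qed

text \<open>
  The \<open>l\<close> letters of the cyclic word \<open>w\<close> from position \<open>s\<close> on, positions being taken modulo the length.
\<close>

definition cyclic_segment :: "'a list \<Rightarrow> nat \<Rightarrow> nat \<Rightarrow> 'a list" where
  "cyclic_segment w s l = map (\<lambda>k. w ! ((s + k) mod length w)) [0..<l]"

lemma cyclic_segment_simps:
  "length (cyclic_segment w s l) = l"
  "j \<le> l \<Longrightarrow> take j (cyclic_segment w s l) = cyclic_segment w s j"
  "drop j (cyclic_segment w s l) = cyclic_segment w (s + j) (l - j)"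
  "j < l \<Longrightarrow> cyclic_segment w s l ! j = w ! ((s + j) mod length w)"
  "cyclic_segment w (s mod length w) l = cyclic_segment w s l"
  by (auto simp: cyclic_segment_def take_map drop_map mod_simps add.assoc intro!: nth_equalityI)

lemma cyclic_segment_rotation:
  assumes "i < length w"
  shows "drop (Suc i) w @ take i w = cyclic_segment w (Suc i) (length w - 1)"
proof (rule nth_equalityI)
  fix k assume "k < length (drop (Suc i) w @ take i w)"
  hence k: "k < length w - 1" using assms by simp
  show "(drop (Suc i) w @ take i w) ! k = cyclic_segment w (Suc i) (length w - 1) ! k"
  proof (cases "Suc i + k < length w")
    case True
    moreover have "k < length w - Suc i" using True by simp
    ultimately show ?thesis using k by (simp add: cyclic_segment_simps nth_append)
  next
    case False
    moreover have "(Suc i + k) mod length w = Suc i + k - length w"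
      using False k assms by (simp add: mod_if)
    moreover have "\<not> k < length w - Suc i" "k - (length w - Suc i) = Suc i + k - length w"
      using assms False by simp_all
    ultimately show ?thesis using k assms by (simp add: cyclic_segment_simps nth_append)
  qed
qed (use assms in \<open>simp add: cyclic_segment_simps\<close>)

lemma set_rotation: "set (drop (Suc i) w @ take i w) \<subseteq> set w"
  by (auto dest: in_set_takeD in_set_dropD)

text \<open>
  A pair \<open>(i, j)\<close> stands for the two distinct positions \<open>i\<close> and \<open>i + 1 + j\<close> on a cycle of length \<open>L\<close>,
  so \<open>j\<close> and \<open>L - 2 - j\<close> are the lengths of the arcs between them. The sum is reindexed by
  exchanging the two positions.
\<close>

lemma sum_cyclic_pairs_involution:
  fixes F :: "nat \<Rightarrow> nat \<Rightarrow> 'a::comm_monoid_add"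
  shows "(\<Sum>i<L. \<Sum>j<L - 1. F i j) = (\<Sum>i<L. \<Sum>j<L - 1. F ((i + 1 + j) mod L) (L - 2 - j))"
proof -
  define A where "A = {..<L} \<times> {..<L - 1}"
  define h where "h p = ((fst p + 1 + snd p) mod L, L - 2 - snd p)" for p :: "nat \<times> nat"
  have hA: "h p \<in> A" and hh: "h (h p) = p" if pA: "p \<in> A" for p
  proof -
    obtain i j where p: "p = (i, j)" "i < L" "j < L - 1"
      using pA unfolding A_def by (cases p) auto
    show "h p \<in> A" using p unfolding h_def A_def by simp
    have "((i + 1 + j) mod L + (1 + (L - 2 - j))) mod L = (i + 1 + j + (1 + (L - 2 - j))) mod L"
      by (rule mod_add_left_eq)
    moreover have "i + 1 + j + (1 + (L - 2 - j)) = i + L" using p by simp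
    ultimately have "((i + 1 + j) mod L + 1 + (L - 2 - j)) mod L = i"
      using p(2) by (simp only: add.assoc mod_add_self2 mod_less)
    thus "h (h p) = p" using p unfolding h_def by simp
  qed
  have "bij_betw h A A"
    by (rule bij_betw_byWitness[where f' = h]) (use hA hh in blast)+
  hence "(\<Sum>p\<in>A. F (fst (h p)) (snd (h p))) = (\<Sum>p\<in>A. F (fst p) (snd p))"
    by (rule sum.reindex_bij_betw)
  thus ?thesis unfolding A_def h_def by (simp add: sum.cartesian_product split_def)
qed

text \<open>
  Both sides are sums over ordered pairs of distinct positions of the cyclic word; the tensor legs are
  the two arcs between these positions, which trade places when the positions do.
\<close>

lemma free_diff_cyclic_word_flip:
  assumes "set w \<subseteq> topological_dual"
    and "1 \<le> m" "1 \<le> n" "\<beta> \<in> carrier_mat m m" "\<beta>' \<in> carrier_mat n n"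
    and "a < m" "b < m" "c < n" "d < n"
  shows "(\<Sum>i<length w. (w ! i) 1 *
      free_diff (fam_word (drop (Suc i) w @ take i w)) m n \<beta> \<beta>' a b c d) =
    (\<Sum>i<length w. (w ! i) 1 *
      free_diff (fam_word (drop (Suc i) w @ take i w)) n m \<beta>' \<beta> c d a b)"
proof -
  define L where "L = length w"
  define x where "x = (\<lambda>i. (w ! (i mod L)) 1)"
  define S where "S = (\<lambda>s l. fam_word (cyclic_segment w s l))"
  have S_mod: "S (s mod L) l = S s l" for s l
    by (simp add: S_def L_def cyclic_segment_simps)
  have S_mod_add: "S (s mod L + k) l = S (s + k) l" for s l k
    using S_mod[of "s mod L + k" l] S_mod[of "s + k" l] by (simp only: mod_add_left_eq)
  have x_mod: "x (s mod L) = x s" "x (s mod L + k) = x (s + k)" for s k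
    by (simp_all only: x_def mod_add_left_eq mod_mod_trivial)
  have expand: "(\<Sum>i<length w. (w ! i) 1 *
      free_diff (fam_word (drop (Suc i) w @ take i w)) m n \<beta> \<beta>' a b c d) =
    (\<Sum>i<L. \<Sum>j<L - 1. x i * x (i + 1 + j) *
      (S (i + 1) j m \<beta> $$ (a, b) * S (i + j + 2) (L - 2 - j) n \<beta>' $$ (c, d)))"
    if mn: "1 \<le> m" "1 \<le> n" "\<beta> \<in> carrier_mat m m" "\<beta>' \<in> carrier_mat n n"
      "a < m" "b < m" "c < n" "d < n" for m n \<beta> \<beta>' a b c d
  proof -
    have "(w ! i) 1 * free_diff (fam_word (drop (Suc i) w @ take i w)) m n \<beta> \<beta>' a b c d =
      (\<Sum>j<L - 1. x i * x (i + 1 + j) *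
        (S (i + 1) j m \<beta> $$ (a, b) * S (i + j + 2) (L - 2 - j) n \<beta>' $$ (c, d)))"
      if i: "i < L" for i
    proof -
      have set: "set (drop (Suc i) w @ take i w) \<subseteq> topological_dual"
        by (rule subset_trans[OF set_rotation assms(1)])
      have "free_diff (fam_word (drop (Suc i) w @ take i w)) m n \<beta> \<beta>' a b c d =
        (\<Sum>j<L - 1. x (i + 1 + j) *
          (S (i + 1) j m \<beta> $$ (a, b) * S (i + j + 2) (L - 2 - j) n \<beta>' $$ (c, d)))"
        unfolding free_diff_word[OF set mn]
        unfolding cyclic_segment_rotation[OF i[unfolded L_def]]
        by (rule sum.cong) (auto simp: cyclic_segment_simps L_def[symmetric] x_def S_def
            add_ac numeral_2_eq_2)
      moreover have "(w ! i) 1 = x i" using i by (simp add: x_def)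
      ultimately show ?thesis by (simp add: sum_distrib_left mult.assoc)
    qed
    thus ?thesis unfolding L_def[symmetric] by (intro sum.cong) auto
  qed
  have swap: "x ((i + 1 + j) mod L) * x ((i + 1 + j) mod L + 1 + (L - 2 - j)) *
      (S ((i + 1 + j) mod L + 1) (L - 2 - j) m \<beta> $$ (a, b) *
        S ((i + 1 + j) mod L + (L - 2 - j) + 2) (L - 2 - (L - 2 - j)) n \<beta>' $$ (c, d)) =
      x i * x (i + 1 + j) *
        (S (i + 1) j n \<beta>' $$ (c, d) * S (i + j + 2) (L - 2 - j) m \<beta> $$ (a, b))"
    if ij: "i < L" "j < L - 1" for i j
  proof -
    have e: "i + 1 + j + (1 + (L - 2 - j)) = i + L" "i + 1 + j + (L - 2 - j + 2) = i + 1 + L"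
      using ij by simp_all
    have 1: "x ((i + 1 + j) mod L + 1 + (L - 2 - j)) = x i"
    proof -
      have "x ((i + 1 + j) mod L + (1 + (L - 2 - j))) = x (i + L)"
        using x_mod(2)[of "i + 1 + j" "1 + (L - 2 - j)"] unfolding e(1) .
      moreover have "x (i + L) = x i" by (simp add: x_def)
      ultimately show ?thesis by (simp only: add.assoc)
    qed
    have 2: "S ((i + 1 + j) mod L + 1) (L - 2 - j) = S (i + j + 2) (L - 2 - j)"
      unfolding S_mod_add by (simp add: add_ac)
    have 3: "S ((i + 1 + j) mod L + (L - 2 - j) + 2) j = S (i + 1) j"
      unfolding add.assoc[of _ "L - 2 - j" 2] S_mod_add e
      using S_mod[of "i + 1 + L" j] S_mod[of "i + 1" j] unfolding mod_add_self2 by (rule trans[OF sym])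
    have 4: "L - 2 - (L - 2 - j) = j" using ij by simp
    show ?thesis unfolding 1 2 3 4 x_mod(1) by (simp only: mult_ac)
  qed
  show ?thesis
    unfolding expand[OF assms(2-9)] expand[OF assms(3,2,5,4,8,9,6,7)]
    by (subst sum_cyclic_pairs_involution) (intro sum.cong refl swap, auto)
qed

lemma free_diff_cyclic_deriv_flip:
  assumes "words_over topological_dual xs"
  shows "free_diff (cyclic_deriv (word_sum xs)) = bifam_flip (free_diff (cyclic_deriv (word_sum xs)))"
proof -
  note ov = words_over_rotations[OF assms]
  have "free_diff (cyclic_deriv (word_sum xs)) m n \<beta> \<beta>' a b c d =
      free_diff (cyclic_deriv (word_sum xs)) n m \<beta>' \<beta> c d a b"
    if mn: "1 \<le> m" "1 \<le> n" "\<beta> \<in> carrier_mat m m" "\<beta>' \<in> carrier_mat n n" for m n \<beta> \<beta>' a b c d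
  proof (cases "a < m \<and> b < m \<and> c < n \<and> d < n")
    case True
    show ?thesis
      unfolding cyclic_deriv_word_sum[OF assms] free_diff_word_sum[OF ov mn]
        free_diff_word_sum[OF ov mn(2,1,4,3)] sum_rotations
      using assms True
      by (intro arg_cong[where f = sum_list] map_cong)
        (auto simp: words_over_def intro!: free_diff_cyclic_word_flip mn)
  next
    case False
    have "\<not> (c < n \<and> d < n \<and> a < m \<and> b < m)" using False by blast
    from free_diff_outside[OF mn(2,1,4,3) this] free_diff_outside[OF mn False] show ?thesis by simp
  qed
  hence flip: "tensor_flip (free_diff (cyclic_deriv (word_sum xs)) n m \<beta>' \<beta>) =
      free_diff (cyclic_deriv (word_sum xs)) m n \<beta> \<beta>'"
    if "1 \<le> m" "1 \<le> n" "\<beta> \<in> carrier_mat m m" "\<beta>' \<in> carrier_mat n n" for m n \<beta> \<beta>'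
    unfolding tensor_flip_def using that by (intro ext) blast
  have "bifam_flip (free_diff (cyclic_deriv (word_sum xs))) =
      restrict_bifamily (free_diff (cyclic_deriv (word_sum xs)))"
    unfolding bifam_flip_def restrict_bifamily_def by (intro ext if_cong refl) (simp add: flip)
  also have "\<dots> = free_diff (cyclic_deriv (word_sum xs))"
    unfolding free_diff_def restrict_bifamily_def by (intro ext) simp
  finally show ?thesis by simp
qed


section \<open>The number operator and the degree in \<open>z(\<theta>)\<close>\<close>

text \<open>\<open>D[p z(\<theta>)] = \<sigma>(\<partial>p) # z(\<theta>) + p\<close>, in coordinates.\<close>

lemma cyclic_deriv_star_entry:
  assumes "\<theta> \<in> topological_dual" "\<theta> 1 = 1" "p \<in> Z_Bd"
    and n: "1 \<le> n" "\<beta> \<in> carrier_mat n n" "a < n" "d < n"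
  shows "cyclic_deriv (cyclic_deriv_star \<theta> p) n \<beta> $$ (a, d) =
    (\<Sum>b<n. \<Sum>c<n. free_diff p n n \<beta> \<beta> c d a b * \<theta> (\<beta> $$ (b, c))) + p n \<beta> $$ (a, d)"
proof -
  have z: "free_diff (zfun \<theta>) n n \<beta> \<beta> e d a b = (if e = d then if b = a then 1 else 0 else 0)"
    if "e < n" "b < n" for e b
    using that assms
    by (simp add: free_diff_zfun bifam_scale_def restrict_bifamily_def fam_tensor_def
        pure_tensor_def tensor_of_def fam_eval)
  have "free_diff (cyclic_deriv_star \<theta> p) n n \<beta> \<beta> b d a b =
      (if b = a then p n \<beta> $$ (a, d) else 0) +
      (\<Sum>e<n. free_diff p n n \<beta> \<beta> b d a e * \<theta> (\<beta> $$ (e, b)))" if b: "b < n" for b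
  proof -
    have "(\<Sum>e<n. p n \<beta> $$ (b, e) * free_diff (zfun \<theta>) n n \<beta> \<beta> e d a b) =
        (\<Sum>e<n. if e = d then (if b = a then p n \<beta> $$ (b, d) else 0) else 0)"
      by (rule sum.cong) (auto simp: z b)
    also have "\<dots> = (if b = a then p n \<beta> $$ (a, d) else 0)" using n by simp
    moreover have "(\<Sum>e<n. free_diff p n n \<beta> \<beta> b d a e * zfun \<theta> n \<beta> $$ (e, b)) =
        (\<Sum>e<n. free_diff p n n \<beta> \<beta> b d a e * \<theta> (\<beta> $$ (e, b)))"
      using n b by (intro sum.cong) (auto simp: fam_eval)
    ultimately show ?thesis
      unfolding cyclic_deriv_star_def
      by (simp only: free_diff_mult[OF assms(3) Z_Bd.zfun[OF assms(1)] n(1,1,2,2) b n(4,3) b])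
  qed
  hence "cyclic_deriv (cyclic_deriv_star \<theta> p) n \<beta> $$ (a, d) =
      (\<Sum>b<n. (if b = a then p n \<beta> $$ (a, d) else 0) +
        (\<Sum>e<n. free_diff p n n \<beta> \<beta> b d a e * \<theta> (\<beta> $$ (e, b))))"
    unfolding cyclic_deriv_entry[OF n] by (intro sum.cong) auto
  also have "\<dots> = p n \<beta> $$ (a, d) +
      (\<Sum>b<n. \<Sum>e<n. free_diff p n n \<beta> \<beta> b d a e * \<theta> (\<beta> $$ (e, b)))"
    using n by (simp add: sum.distrib)
  also have "(\<Sum>b<n. \<Sum>e<n. free_diff p n n \<beta> \<beta> b d a e * \<theta> (\<beta> $$ (e, b))) =
      (\<Sum>e<n. \<Sum>b<n. free_diff p n n \<beta> \<beta> b d a e * \<theta> (\<beta> $$ (e, b)))"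
    by (rule sum.swap)
  finally show ?thesis by (simp only: add.commute)
qed

lemma number_op_entry:
  assumes "1 \<le> n" "\<beta> \<in> carrier_mat n n" "a < n" "d < n"
  shows "number_op \<theta> f n \<beta> $$ (a, d) =
    (\<Sum>b<n. \<Sum>c<n. free_diff f n n \<beta> \<beta> a b c d * \<theta> (\<beta> $$ (b, c)))"
  using assms
  by (simp add: number_op_def free_diff_star_def restrict_family_def tensor_hash_def fam_eval)

lemma L_op_entry:
  assumes "p \<in> Z_Bd" "1 \<le> n" "\<beta> \<in> carrier_mat n n" "a < n" "d < n"
  shows "L_op \<theta> p n \<beta> $$ (a, d) = number_op \<theta> p n \<beta> $$ (a, d) + p n \<beta> $$ (a, d)"
  using carrier_matD[OF Z_Bd_carrier[OF assms(1-3)]] assms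
  by (simp add: L_op_def fam_eval)

text \<open>
  Euler's identity: inserting \<open>z(\<theta>)\<close> back where a letter \<open>\<theta>\<close> was removed restores the word, and the
  other letters do not contribute since they vanish at 1.
\<close>

lemma number_op_word:
  assumes \<theta>: "\<theta> \<in> topological_dual" "\<theta> 1 = 1" and w: "set w \<subseteq> graded_letters \<theta>"
    and n: "1 \<le> n" "\<beta> \<in> carrier_mat n n" "a < n" "d < n"
  shows "number_op \<theta> (fam_word w) n \<beta> $$ (a, d) =
    of_nat (count_list w \<theta>) * fam_word w n \<beta> $$ (a, d)"
proof -
  have wd: "set w \<subseteq> topological_dual" using w by (auto simp: graded_letters_def)
  note cr = fam_word_carrier[OF n(1,2)]
  have insert: "(\<Sum>b<n. \<Sum>c<n. fam_word u n \<beta> $$ (a, b) * fam_word v n \<beta> $$ (c, d) * \<theta> (\<beta> $$ (b, c))) =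
      fam_word (u @ \<theta> # v) n \<beta> $$ (a, d)" for u v
  proof -
    have "fam_word (u @ \<theta> # v) n \<beta> = fam_word u n \<beta> * (map_mat \<theta> \<beta> * fam_word v n \<beta>)"
      using n by (simp add: fam_word_append fam_eval)
    thus ?thesis using cr[of u] cr[of v] n
      by (simp add: scalar_prod_def atLeast0LessThan sum_distrib_left mult_ac)
  qed
  have "number_op \<theta> (fam_word w) n \<beta> $$ (a, d) =
      (\<Sum>b<n. \<Sum>c<n. \<Sum>i<length w. (w ! i) 1 * (fam_word (take i w) n \<beta> $$ (a, b) *
        fam_word (drop (Suc i) w) n \<beta> $$ (c, d) * \<theta> (\<beta> $$ (b, c))))"
    unfolding number_op_entry[OF n]
    by (intro sum.cong refl)
      (simp add: free_diff_word[OF wd n(1,1,2,2) n(3) _ _ n(4)] sum_distrib_right mult.assoc)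
  also have "\<dots> = (\<Sum>b<n. \<Sum>i<length w. \<Sum>c<n. (w ! i) 1 * (fam_word (take i w) n \<beta> $$ (a, b) *
        fam_word (drop (Suc i) w) n \<beta> $$ (c, d) * \<theta> (\<beta> $$ (b, c))))"
    by (intro sum.cong refl sum.swap)
  also have "\<dots> = (\<Sum>i<length w. \<Sum>b<n. \<Sum>c<n. (w ! i) 1 * (fam_word (take i w) n \<beta> $$ (a, b) *
        fam_word (drop (Suc i) w) n \<beta> $$ (c, d) * \<theta> (\<beta> $$ (b, c))))"
    by (rule sum.swap)
  also have "\<dots> = (\<Sum>i<length w. (w ! i) 1 * fam_word (take i w @ \<theta> # drop (Suc i) w) n \<beta> $$ (a, d))"
    by (simp only: insert[symmetric] sum_distrib_left)
  also have "\<dots> = (\<Sum>i<length w. of_bool (w ! i = \<theta>) * fam_word w n \<beta> $$ (a, d))"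
  proof (rule sum.cong[OF refl])
    fix i assume "i \<in> {..<length w}"
    hence i: "i < length w" by simp
    hence "w ! i \<in> graded_letters \<theta>" using w nth_mem by blast
    thus "(w ! i) 1 * fam_word (take i w @ \<theta> # drop (Suc i) w) n \<beta> $$ (a, d) =
        of_bool (w ! i = \<theta>) * fam_word w n \<beta> $$ (a, d)"
      using \<theta> id_take_nth_drop[OF i] by (auto simp: graded_letters_def)
  qed
  also have "\<dots> = (\<Sum>i<length w. of_bool (w ! i = \<theta>)) * fam_word w n \<beta> $$ (a, d)"
    by (rule sum_distrib_right[symmetric])
  also have "(\<Sum>i<length w. of_bool (w ! i = \<theta>)) = (of_nat (count_list w \<theta>) :: complex)"
    by (induction w) (simp_all add: sum.lessThan_Suc_shift del: sum.lessThan_Suc)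
  finally show ?thesis .
qed

lemma number_op_word_sum:
  assumes \<theta>: "\<theta> \<in> topological_dual" "\<theta> 1 = 1" and xs: "words_over (graded_letters \<theta>) xs"
    and n: "1 \<le> n" "\<beta> \<in> carrier_mat n n" "a < n" "d < n"
  shows "number_op \<theta> (word_sum xs) n \<beta> $$ (a, d) =
    (\<Sum>(r, w)\<leftarrow>xs. r * (of_nat (count_list w \<theta>) * fam_word w n \<beta> $$ (a, d)))"
proof -
  have xd: "words_over topological_dual xs"
    using xs by (auto simp: words_over_def graded_letters_def)
  have "number_op \<theta> (word_sum xs) n \<beta> $$ (a, d) =
      (\<Sum>(r, w)\<leftarrow>xs. r * number_op \<theta> (fam_word w) n \<beta> $$ (a, d))"
    unfolding number_op_entry[OF n] free_diff_word_sum[OF xd n(1,1,2,2)]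
    by (simp add: split_def sum_distrib_left mult.assoc flip: sum_list_sum_swap sum_list_mult_const)
  also have "\<dots> = (\<Sum>(r, w)\<leftarrow>xs. r * (of_nat (count_list w \<theta>) * fam_word w n \<beta> $$ (a, d)))"
    using xs by (intro arg_cong[where f = sum_list] map_cong)
      (auto simp: words_over_def number_op_word[OF \<theta> _ n])
  finally show ?thesis .
qed

text \<open>
  The substitution \<open>\<beta> \<mapsto> \<beta> + (t - 1) \<theta>(\<beta>) \<otimes> 1\<close>. If \<open>\<theta>(1) = 1\<close>, it multiplies \<open>z(\<theta>)\<close> by \<open>t\<close>, and it does
  not change \<open>z(\<phi>)\<close> if \<open>\<phi>(1) = 0\<close>; so it reads off the degree of a word.
\<close>

definition dilation :: "('b::complex_banach_algebra_1 \<Rightarrow> complex) \<Rightarrow> complex \<Rightarrow> 'b mat \<Rightarrow> 'b mat" where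
  "dilation \<theta> t \<beta> = map_mat (\<lambda>x. x + ((t - 1) * \<theta> x) *\<^sub>C 1) \<beta>"

lemma dilation_carrier: "\<beta> \<in> carrier_mat m n \<Longrightarrow> dilation \<theta> t \<beta> \<in> carrier_mat m n"
  by (simp add: dilation_def)

lemma fam_word_dilation:
  assumes \<theta>: "\<theta> \<in> topological_dual" "\<theta> 1 = 1" and w: "set w \<subseteq> graded_letters \<theta>"
    and n: "1 \<le> n" "\<beta> \<in> carrier_mat n n"
  shows "fam_word w n (dilation \<theta> t \<beta>) = t ^ count_list w \<theta> \<cdot>\<^sub>m fam_word w n \<beta>"
  using w
proof (induction w)
  case Nil
  show ?case using n by (simp add: fam_eval dilation_carrier) (intro eq_matI; simp)
next
  case (Cons \<phi> w)
  have \<phi>: "\<phi> \<in> topological_dual" "\<phi> = \<theta> \<or> \<phi> 1 = 0"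
    using Cons.prems by (auto simp: graded_letters_def)
  have "map_mat \<phi> (dilation \<theta> t \<beta>) = (if \<phi> = \<theta> then t else 1) \<cdot>\<^sub>m map_mat \<phi> \<beta>"
    using \<phi> \<theta> n by (intro eq_matI) (auto simp: dilation_def dual_add dual_scaleC algebra_simps)
  thus ?case
    using Cons n fam_word_carrier[OF n, of w]
    by (auto simp: fam_eval dilation_carrier mult_smult_distrib[of _ n n _ n]
        mult_smult_assoc_mat[of _ n n _ n] mult_ac intro!: eq_matI)
qed

lemma cyclic_deriv_word_dilation:
  assumes \<theta>: "\<theta> \<in> topological_dual" "\<theta> 1 = 1" and w: "set w \<subseteq> graded_letters \<theta>"
    and n: "1 \<le> n" "\<beta> \<in> carrier_mat n n" "a < n" "d < n"
  shows "cyclic_deriv (fam_word w) n (dilation \<theta> t \<beta>) $$ (a, d) =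
    t ^ (count_list w \<theta> - 1) * cyclic_deriv (fam_word w) n \<beta> $$ (a, d)"
proof -
  have wd: "set w \<subseteq> topological_dual" using w by (auto simp: graded_letters_def)
  have "(w ! i) 1 * fam_word (drop (Suc i) w @ take i w) n (dilation \<theta> t \<beta>) $$ (a, d) =
      t ^ (count_list w \<theta> - 1) * ((w ! i) 1 * fam_word (drop (Suc i) w @ take i w) n \<beta> $$ (a, d))"
    if i: "i < length w" for i
  proof (cases "(w ! i) 1 = 0")
    case False
    \<comment> \<open>A letter that contributes is \<open>\<theta>\<close>, so its removal lowers the degree by one.\<close>
    have "w ! i \<in> graded_letters \<theta>" using i w nth_mem by blast
    hence eq: "w ! i = \<theta>" using False by (simp add: graded_letters_def)
    have "count_list w \<theta> = count_list (take i w @ w ! i # drop (Suc i) w) \<theta>"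
      using id_take_nth_drop[OF i] by simp
    hence cnt: "count_list (drop (Suc i) w @ take i w) \<theta> = count_list w \<theta> - 1"
      using eq by simp
    have "set (drop (Suc i) w @ take i w) \<subseteq> graded_letters \<theta>"
      by (rule subset_trans[OF set_rotation w])
    from fam_word_dilation[OF \<theta> this n(1,2), of t] cnt show ?thesis
      using carrier_matD[OF fam_word_carrier[OF n(1,2), of "drop (Suc i) w @ take i w"]] n by simp
  qed simp
  thus ?thesis
    unfolding cyclic_deriv_word[OF wd n] cyclic_deriv_word[OF wd n(1) dilation_carrier[OF n(2)] n(3,4)]
    unfolding sum_distrib_left by (intro sum.cong refl) auto
qed

text \<open>
  The integral over \<open>[0, 1]\<close> of a polynomial that vanishes identically.
\<close>

lemma weighted_power_sum_zero:
  fixes c :: "'a \<Rightarrow> complex"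
  assumes "\<And>t. (\<Sum>x\<leftarrow>xs. c x * t ^ d x) = 0"
  shows "(\<Sum>x\<leftarrow>xs. c x / of_nat (Suc (d x))) = 0"
proof -
  \<comment> \<open>An antiderivative of the given polynomial; it is constant, hence \<open>F 1 = F 0\<close>.\<close>
  define F where "F t = (\<Sum>x\<leftarrow>xs. c x / of_nat (Suc (d x)) * t ^ Suc (d x))" for t
  have "(F has_field_derivative (\<Sum>x\<leftarrow>xs. c x * t ^ d x)) (at t)" for t
    unfolding F_def
  proof (induction xs)
    case (Cons x xs)
    have "((\<lambda>t. c x / of_nat (Suc (d x)) * t ^ Suc (d x)) has_field_derivative
        c x / of_nat (Suc (d x)) * (of_nat (Suc (d x)) * t ^ d x)) (at t)"
      by (auto intro!: derivative_eq_intros simp del: of_nat_Suc power_Suc)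
    hence "((\<lambda>t. c x / of_nat (Suc (d x)) * t ^ Suc (d x)) has_field_derivative c x * t ^ d x) (at t)"
      by (simp del: of_nat_Suc power_Suc)
    from DERIV_add[OF this Cons.IH] show ?case by simp
  qed simp
  hence "(F has_field_derivative 0) (at t)" for t using assms by simp
  hence "\<exists>k. \<forall>t\<in>UNIV. F t = k"
    by (intro has_field_derivative_zero_constant) auto
  hence "F 1 = F 0" by auto
  moreover have "F 0 = 0" unfolding F_def by (induction xs) auto
  ultimately show ?thesis by (simp add: F_def)
qed

section \<open>The equivalence\<close>

lemma cyclic_deriv_star_eq_L_op:
  assumes "\<theta> \<in> topological_dual" "\<theta> 1 = 1" "p \<in> Z_Bd"
    and sym: "free_diff p = bifam_flip (free_diff p)"
  shows "cyclic_deriv (cyclic_deriv_star \<theta> p) = L_op \<theta> p"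
proof (rule family_eqI[OF restrict_cyclic_deriv])
  show "restrict_family (L_op \<theta> p) = L_op \<theta> p" unfolding L_op_def by (rule restrict_fam_ops)
  fix n :: nat and \<beta> :: "'a mat" assume n: "1 \<le> n" "\<beta> \<in> carrier_mat n n"
  have flip: "free_diff p n n \<beta> \<beta> c d a b = free_diff p n n \<beta> \<beta> a b c d" for a b c d
  proof -
    have "free_diff p n n \<beta> \<beta> c d a b = bifam_flip (free_diff p) n n \<beta> \<beta> c d a b"
      using sym by (rule arg_cong)
    also have "\<dots> = free_diff p n n \<beta> \<beta> a b c d"
      using n by (simp add: bifam_flip_def restrict_bifamily_def tensor_flip_def)
    finally show ?thesis .
  qed
  show "cyclic_deriv (cyclic_deriv_star \<theta> p) n \<beta> = L_op \<theta> p n \<beta>"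
  proof (rule eq_matI)
    have L: "L_op \<theta> p n \<beta> \<in> carrier_mat n n"
      using Z_Bd_carrier[OF assms(3) n] n by (simp add: L_op_def fam_eval)
    show "dim_row (cyclic_deriv (cyclic_deriv_star \<theta> p) n \<beta>) = dim_row (L_op \<theta> p n \<beta>)"
      "dim_col (cyclic_deriv (cyclic_deriv_star \<theta> p) n \<beta>) = dim_col (L_op \<theta> p n \<beta>)"
      using L cyclic_deriv_carrier[OF n] by auto
    fix a d assume "a < dim_row (L_op \<theta> p n \<beta>)" "d < dim_col (L_op \<theta> p n \<beta>)"
    hence ad: "a < n" "d < n" using L by auto
    show "cyclic_deriv (cyclic_deriv_star \<theta> p) n \<beta> $$ (a, d) = L_op \<theta> p n \<beta> $$ (a, d)"
      unfolding cyclic_deriv_star_entry[OF assms(1-3) n ad] L_op_entry[OF assms(3) n ad]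
        number_op_entry[OF n ad]
      by (intro arg_cong2[where f = "(+)"] sum.cong refl arg_cong2[where f = "(*)"] flip)
  qed
qed

text \<open>
  In the proof \<open>E w\<close> and \<open>W w\<close> are entries of \<open>D[w z(\<theta>)]\<close> and of \<open>w\<close> at a point \<open>\<beta>\<close>, both
  homogeneous of degree \<open>k w\<close> under the dilations of \<open>\<beta>\<close>.
\<close>

lemma ex_cyclic_primitive:
  assumes \<theta>: "\<theta> \<in> topological_dual" "\<theta> 1 = 1" and "p \<in> Z_Bd"
    and L: "cyclic_deriv (cyclic_deriv_star \<theta> p) = L_op \<theta> p"
  shows "\<exists>q\<in>Z_Bd. cyclic_deriv q = p"
proof -
  obtain xs where xs: "words_over (graded_letters \<theta>) xs" and p: "p = word_sum xs"
    using Z_Bd_word_sum[OF \<theta> assms(3)] by blast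
  define ys where "ys = map (\<lambda>(c, w). (c, w @ [\<theta>])) xs"
  define zs where "zs = map (\<lambda>(c, w). (c / of_nat (Suc (count_list w \<theta>)), w @ [\<theta>])) xs"
  have ov: "words_over topological_dual xs" "words_over topological_dual ys" "words_over topological_dual zs"
    using xs \<theta>(1) by (fastforce simp: words_over_def graded_letters_def ys_def zs_def)+
  have "zfun \<theta> = word_sum [(1, [\<theta>])]"
    by (rule word_sum_eqI[OF Z_Bd_restrict[OF Z_Bd.zfun[OF \<theta>(1)]]]) (auto simp: fam_eval)
  moreover have "concat (map (\<lambda>(c, u). map (\<lambda>(d, v). (c * d, u @ v)) [(1, [\<theta>])]) xs) = ys"
    unfolding ys_def by (induction xs) auto
  ultimately have star: "cyclic_deriv_star \<theta> p = word_sum ys"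
    unfolding cyclic_deriv_star_def p by (simp only: fam_mult_word_sum)
  have "cyclic_deriv (word_sum zs) = p"
    unfolding p
  proof (rule word_sum_eqI[OF restrict_cyclic_deriv cyclic_deriv_carrier])
    fix n :: nat and \<beta> :: "'a mat" and a d
    assume n: "1 \<le> n" "\<beta> \<in> carrier_mat n n" and ad: "a < n" "d < n"
    define E where "E w = cyclic_deriv (fam_word (w @ [\<theta>])) n \<beta> $$ (a, d)" for w
    define W where "W w = fam_word w n \<beta> $$ (a, d)" for w
    define k where "k w = count_list w \<theta>" for w
    have "(\<Sum>x\<leftarrow>xs. fst x * (E (snd x) - of_nat (Suc (k (snd x))) * W (snd x)) * t ^ k (snd x)) = 0"
      for t
    proof -
      have nt: "1 \<le> n" "dilation \<theta> t \<beta> \<in> carrier_mat n n" using n by (auto intro: dilation_carrier)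
      have gr: "set (w @ [\<theta>]) \<subseteq> graded_letters \<theta>" "set w \<subseteq> graded_letters \<theta>" if "(c, w) \<in> set xs" for c w
        using xs \<theta> that by (auto simp: words_over_def graded_letters_def)
      have "(\<Sum>(c, w)\<leftarrow>xs. c * (E w * t ^ k w)) =
          cyclic_deriv (word_sum ys) n (dilation \<theta> t \<beta>) $$ (a, d)"
        unfolding cyclic_deriv_word_sum_entry[OF ov(2) nt ad] unfolding ys_def
        by (auto intro!: arg_cong[where f = sum_list] map_cong
          simp: o_def split_def E_def k_def cyclic_deriv_word_dilation[OF \<theta> gr(1) n ad] mult_ac)
      also have "\<dots> = L_op \<theta> p n (dilation \<theta> t \<beta>) $$ (a, d)"
        using L unfolding star by simp
      also have "\<dots> = (\<Sum>(c, w)\<leftarrow>xs. c * (of_nat (k w) * fam_word w n (dilation \<theta> t \<beta>) $$ (a, d))) +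
          (\<Sum>(c, w)\<leftarrow>xs. c * fam_word w n (dilation \<theta> t \<beta>) $$ (a, d))"
        unfolding L_op_entry[OF assms(3) nt ad] unfolding p k_def
        by (simp only: number_op_word_sum[OF \<theta> xs nt ad] word_sum_entry[OF nt ad])
      also have "\<dots> = (\<Sum>(c, w)\<leftarrow>xs. c * (of_nat (Suc (k w)) * fam_word w n (dilation \<theta> t \<beta>) $$ (a, d)))"
        by (induction xs) (auto simp: algebra_simps)
      also have "\<dots> = (\<Sum>(c, w)\<leftarrow>xs. c * (of_nat (Suc (k w)) * W w * t ^ k w))"
        using carrier_matD[OF fam_word_carrier[OF n]] ad
        by (auto intro!: arg_cong[where f = sum_list] map_cong
          simp: W_def k_def fam_word_dilation[OF \<theta> gr(2) n])
      finally show ?thesis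
        by (simp add: split_def algebra_simps sum_list_subtractf)
    qed
    from weighted_power_sum_zero[OF this]
    have "(\<Sum>x\<leftarrow>xs. fst x / of_nat (Suc (k (snd x))) * E (snd x)) = (\<Sum>x\<leftarrow>xs. fst x * W (snd x))"
      by (simp add: right_diff_distrib diff_divide_distrib sum_list_subtractf del: of_nat_Suc)
    thus "cyclic_deriv (word_sum zs) n \<beta> $$ (a, d) = (\<Sum>(c, w)\<leftarrow>xs. c * fam_word w n \<beta> $$ (a, d))"
      unfolding cyclic_deriv_word_sum_entry[OF ov(3) n ad] unfolding zs_def
      by (simp add: o_def split_def E_def W_def k_def)
  qed
  thus ?thesis using word_sum_in_Z_Bd[OF ov(3)] by blast
qed

theorem theorem7p5:
  fixes \<theta> :: "'b::complex_banach_algebra_1 \<Rightarrow> complex"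
    and p :: "'b family"
  assumes "\<theta> \<in> topological_dual" and "\<theta> 1 = 1" and "p \<in> Z_Bd"
  shows "((\<exists>q\<in>Z_Bd. cyclic_deriv q = p) \<longleftrightarrow> free_diff p = bifam_flip (free_diff p)) \<and>
         (free_diff p = bifam_flip (free_diff p) \<longleftrightarrow>
            cyclic_deriv (cyclic_deriv_star \<theta> p) = L_op \<theta> p)"
proof -
  have "free_diff p = bifam_flip (free_diff p)" if q: "q \<in> Z_Bd" "cyclic_deriv q = p" for q
  proof -
    obtain xs where xs: "words_over (graded_letters \<theta>) xs" "q = word_sum xs"
      using Z_Bd_word_sum[OF assms(1,2) q(1)] by blast
    hence "words_over topological_dual xs" by (auto simp: words_over_def graded_letters_def)
    from free_diff_cyclic_deriv_flip[OF this] show ?thesis using xs(2) q(2) by simp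
  qed
  thus ?thesis
    using cyclic_deriv_star_eq_L_op[OF assms] ex_cyclic_primitive[OF assms] by blast
qed

end
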